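(* Let $(X_1,Y_1),(X_2,Y_2),\dots$ be a random sample (i.i.d. copies) of a random vector $(X,Y)$ with continuous joint distribution function $H$, marginal distribution functions $F$ and $G$, and (unique) copula $A$. Assume that $A$ allows a continuous Markov kernel $K_A$, define $K_H(x,(-\infty,y]):=K_A(F(x),[0,G(y)])$, and set $N(n):=\lfloor n^s\rfloor$ for some $s\in(0,\tfrac12)$. Let $\alpha\in(0,1)$ and let $x\in\mathbb{R}$ be a point in which the regularity assumption holds, i.e. the sequence $(Z_n^{(x)})_{n\in\mathbb{N}}$ is uniformly integrable, where $Z_n^{(x)}$ has distribution function $y\mapsto K_{\mathcal{CB}_{N(n)}(E_n)}(F_n(x),[0,G_n(y)])$. Let $e_\alpha(x)$ be the conditional $\alpha$-expectile, i.e. the unique solution $e$ of $$\alpha\int_e^\infty 1-K_H(x,(-\infty,y])\,d\lambda(y)=(1-\alpha)\int_{-\infty}^e K_H(x,(-\infty,y])\,d\lambda(y),$$ and for every $n\in\mathbb{N}$ let $t_n\in\mathbb{R}$ be the solution of $$\alpha\int_{t_n}^\infty 1-K_{\mathcal{CB}_{N(n)}(E_n)}(F_n(x),[0,G_n(y)])\,d\lambda(y)=(1-\alpha)\int_{-\infty}^{t_n}K_{\mathcal{CB}_{N(n)}(E_n)}(F_n(x),[0,G_n(y)])\,d\lambda(y).$$ Then $t_n\to e_\alpha(x)$ almost surely as $n\to\infty$.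
   Context: A (bivariate) copula is a distribution function on $[0,1]^2$ with uniform marginals; each copula $B$ corresponds to a doubly stochastic measure $\mu_B$ with $B(x,y)=\mu_B([0,x]\times[0,y])$. A Markov kernel of a copula $B$ is a map $K_B:[0,1]\times\mathcal{B}([0,1])\to[0,1]$, measurable in the first argument, a probability measure in the second, with $\int_{E_1}K_B(x,E_2)\,d\lambda(x)=\mu_B(E_1\times E_2)$ for all Borel $E_1,E_2\subseteq[0,1]$ ($\lambda$ = Lebesgue measure). $A$ allows a continuous Markov kernel if it has a version $K_A$ with $(x,y)\mapsto K_A(x,[0,y])$ continuous on $[0,1]^2$; $K_A$ denotes this version. Checkerboard approximation: $I_1^N=[0,\tfrac1N]$, $I_i^N=(\tfrac{i-1}N,\tfrac iN]$ ($i=2,\dots,N$), $Q_{i,j}^N=I_i^N\times I_j^N$; for a copula $B$, $K_{\mathcal{CB}_N(B)}(u,[0,v])=N^2\sum_{i,j=1}^N\mu_B(Q^N_{i,j})\mathbf 1_{I^N_i}(u)\,\lambda([0,v]\cap I^N_j)$ is the Markov kernel of the absolutely continuous copula $\mathcal{CB}_N(B)$ with density $N^2\sum_{i,j}\mu_B(Q^N_{i,j})\mathbf 1_{Q^N_{i,j}}$. $F_n,G_n$ are the univariate empirical distribution functions of the first $n$ observations; $E_n$ is the empirical copula: with $H_n$ the bivariate empirical distribution function, almost surely there is a unique subcopula $E_n'$ on $\{0,\tfrac1n,\dots,1\}^2$ with $H_n(x,y)=E_n'(F_n(x),G_n(y))$, and $E_n$ is its extension to a copula by bilinear interpolation on each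 square $[\tfrac{i-1}n,\tfrac in]\times[\tfrac{j-1}n,\tfrac jn]$. *)

theory Defs
  imports "HOL-Probability.Probability"
begin

definition doubly_stochastic :: "(real \<times> real) measure \<Rightarrow> bool" where
  "doubly_stochastic \<mu> \<longleftrightarrow>
     prob_space \<mu> \<and> sets \<mu> = sets (borel :: (real \<times> real) measure) \<and>
     emeasure \<mu> ({0..1} \<times> {0..1}) = 1 \<and>
     (\<forall>a\<in>{0..1}. measure \<mu> ({0..a} \<times> UNIV) = a \<and> measure \<mu> (UNIV \<times> {0..a}) = a)"

definition copula_of :: "(real \<times> real) measure \<Rightarrow> real \<Rightarrow> real \<Rightarrow> real" where
  "copula_of \<mu> u v = measure \<mu> ({0..u} \<times> {0..v})"

definition is_copula :: "(real \<Rightarrow> real \<Rightarrow> real) \<Rightarrow> bool" where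
  "is_copula B \<longleftrightarrow> (\<exists>\<mu>. doubly_stochastic \<mu> \<and>
      (\<forall>u\<in>{0..1}. \<forall>v\<in>{0..1}. B u v = copula_of \<mu> u v))"

definition mu_of :: "(real \<Rightarrow> real \<Rightarrow> real) \<Rightarrow> (real \<times> real) measure" where
  "mu_of B = (THE \<mu>. doubly_stochastic \<mu> \<and>
      (\<forall>u\<in>{0..1}. \<forall>v\<in>{0..1}. B u v = copula_of \<mu> u v))"

abbreviation unit_borel :: "real measure" where
  "unit_borel \<equiv> restrict_space borel {0..1}"

definition markov_kernel_of :: "(real \<times> real) measure \<Rightarrow> (real \<Rightarrow> real measure) \<Rightarrow> bool" where
  "markov_kernel_of \<mu> K \<longleftrightarrow>
     (\<forall>x\<in>{0..1}. prob_space (K x) \<and> sets (K x) = sets unit_borel) \<and>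
     (\<forall>E\<in>sets unit_borel. (\<lambda>x. measure (K x) E) \<in> borel_measurable unit_borel) \<and>
     (\<forall>E1\<in>sets unit_borel. \<forall>E2\<in>sets unit_borel.
        (LINT x:E1|lborel. measure (K x) E2) = measure \<mu> (E1 \<times> E2))"

definition continuous_markov_kernel_of :: "(real \<times> real) measure \<Rightarrow> (real \<Rightarrow> real measure) \<Rightarrow> bool" where
  "continuous_markov_kernel_of \<mu> K \<longleftrightarrow> markov_kernel_of \<mu> K \<and>
     continuous_on ({0..1} \<times> {0..1}) (\<lambda>(x, y). measure (K x) {0..y})"

definition cb_I :: "nat \<Rightarrow> nat \<Rightarrow> real set" where
  "cb_I N i = (if i = 1 then {0..1 / real N} else {(real i - 1) / real N<..real i / real N})"

definition cb_Q :: "nat \<Rightarrow> nat \<Rightarrow> nat \<Rightarrow> (real \<times> real) set" where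
  "cb_Q N i j = cb_I N i \<times> cb_I N j"

definition cb_kernel :: "nat \<Rightarrow> (real \<Rightarrow> real \<Rightarrow> real) \<Rightarrow> real \<Rightarrow> real \<Rightarrow> real" where
  "cb_kernel N B u v = (real N)\<^sup>2 * (\<Sum>i\<in>{1..N}. \<Sum>j\<in>{1..N}.
      measure (mu_of B) (cb_Q N i j) * indicator (cb_I N i) u *
      measure lborel ({0..v} \<inter> cb_I N j))"

definition emp_F :: "(nat \<Rightarrow> 'a \<Rightarrow> real) \<Rightarrow> nat \<Rightarrow> 'a \<Rightarrow> real \<Rightarrow> real" where
  "emp_F X n \<omega> x = real (card {i\<in>{..<n}. X i \<omega> \<le> x}) / real n"

definition emp_H :: "(nat \<Rightarrow> 'a \<Rightarrow> real) \<Rightarrow> (nat \<Rightarrow> 'a \<Rightarrow> real) \<Rightarrow> nat \<Rightarrow> 'a \<Rightarrow> real \<Rightarrow> real \<Rightarrow> real" where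
  "emp_H X Y n \<omega> x y = real (card {i\<in>{..<n}. X i \<omega> \<le> x \<and> Y i \<omega> \<le> y}) / real n"

text \<open>The subcopula E_n' at the grid point (i/n, j/n): E_n'(F_n x, G_n y) = H_n(x,y).\<close>
definition emp_subcopula :: "(nat \<Rightarrow> 'a \<Rightarrow> real) \<Rightarrow> (nat \<Rightarrow> 'a \<Rightarrow> real) \<Rightarrow> nat \<Rightarrow> 'a \<Rightarrow> nat \<Rightarrow> nat \<Rightarrow> real" where
  "emp_subcopula X Y n \<omega> i j =
     emp_H X Y n \<omega> (SOME x. emp_F X n \<omega> x = real i / real n)
                   (SOME y. emp_F Y n \<omega> y = real j / real n)"

text \<open>The empirical copula E_n: bilinear interpolation of E_n' on each grid square.\<close>
definition emp_copula :: "(nat \<Rightarrow> 'a \<Rightarrow> real) \<Rightarrow> (nat \<Rightarrow> 'a \<Rightarrow> real) \<Rightarrow> nat \<Rightarrow> 'a \<Rightarrow> real \<Rightarrow> real \<Rightarrow> real" where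
  "emp_copula X Y n \<omega> u v =
     (let p = min (nat \<lfloor>real n * u\<rfloor>) (n - 1); q = min (nat \<lfloor>real n * v\<rfloor>) (n - 1);
          a = real n * u - real p; b = real n * v - real q;
          E = emp_subcopula X Y n \<omega>
      in (1 - a) * (1 - b) * E p q + a * (1 - b) * E (Suc p) q
         + (1 - a) * b * E p (Suc q) + a * b * E (Suc p) (Suc q))"

definition expectile_eq :: "real \<Rightarrow> (real \<Rightarrow> real) \<Rightarrow> real \<Rightarrow> bool" where
  "expectile_eq \<alpha> D t \<longleftrightarrow>
     ennreal \<alpha> * (\<integral>\<^sup>+ y. ennreal (1 - D y) * indicator {t..} y \<partial>lborel) =
     ennreal (1 - \<alpha>) * (\<integral>\<^sup>+ y. ennreal (D y) * indicator {..t} y \<partial>lborel)"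

definition unif_integrable_dfs :: "(nat \<Rightarrow> real \<Rightarrow> real) \<Rightarrow> bool" where
  "unif_integrable_dfs D \<longleftrightarrow>
     (\<forall>\<epsilon>>0. \<exists>c. \<forall>n\<ge>1.
        (\<integral>\<^sup>+ z. ennreal \<bar>z\<bar> * indicator {z. c \<le> \<bar>z\<bar>} z \<partial>interval_measure (D n)) < ennreal \<epsilon>)"

end

(* The function t |-> alpha * int_t^oo (1 - D) - (1 - alpha) * int_-oo^t D has slope at most
   -min(alpha, 1 - alpha) for every distribution function D, so |t_n - e| is bounded by a multiple
   of its value at e for D = D_n. That value tends to 0 once D_n -> D pointwise, as uniform
   integrability controls the tails.
   For the pointwise convergence pass to the uniform variables U = F(X), V = G(Y), whose joint law is
   the copula measure. Hoeffding's inequality and Borel-Cantelli bound the deviation of their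
   empirical distribution on the grid {0, 1/n, ..., 1}^2 by n^-t for some t in (s, 1/2). Ranks do not
   change under F and G, so E_n is within 3 n^-t + 2/n of A. The checkerboard kernel in row i
   lies between the scaled increments N * (E_n(i/N, w) - E_n((i-1)/N, w)) at the two grid points w
   next to v; these differ by O(N n^-t) = o(1) from averages of the continuous kernel over a row of
   width 1/N. *)
theory Submission
  imports Defs "HOL-Probability.Hoeffding" "HOL-Real_Asymp.Real_Asymp"
begin

section \<open>Convergence of expectiles\<close>

text \<open>A Glivenko-Cantelli limit without a rate would not do: the checkerboard kernel is a
  difference quotient over a row of width 1/N, so every error of E_n is multiplied by N. The
  condition s < 1/2 leaves room for an error rate that beats this factor while Hoeffding's bound
  stays summable over all (n + 1)^2 grid points. The row is chosen by the random point F_n(x), not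
  by F(x), so continuity of the kernel is needed in a whole neighbourhood of the limit point.

  The measure of E_n enters through a definite description; it has to be exhibited and shown to be
  unique. It is the law of a uniform point in the grid cell of a randomly chosen pair of ranks. F
  and G are only nondecreasing: ties in the transformed sample are excluded almost surely because
  continuity of H leaves no atoms, and a flat piece of F or G changes a count by at most one.

  All randomness is confined to an event (no ties, small grid errors, uniform integrability) that
  does not depend on y, so D_n converges at every y simultaneously, as the integrals
  require.\<close>

lemma Vitali_tails:
  fixes h :: "nat \<Rightarrow> real \<Rightarrow> real" and g :: "real \<Rightarrow> real"
  assumes meas [measurable]: "\<And>n. h n \<in> borel_measurable borel"
    and range: "\<And>n y. 0 \<le> h n y" "\<And>n y. h n y \<le> 1"
    and lim: "\<And>y. (\<lambda>n. h n y) \<longlonglongrightarrow> g y"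
    and tail: "\<And>\<epsilon>. \<epsilon> > 0 \<Longrightarrow> \<exists>c. \<forall>n. (\<integral>\<^sup>+y. ennreal (h n y * indicator {y. \<bar>y\<bar> > c} y) \<partial>lborel) \<le> ennreal \<epsilon>"
  shows "\<And>n. integrable lborel (h n)" "integrable lborel g"
    and "(\<lambda>n. integral\<^sup>L lborel (h n)) \<longlonglongrightarrow> integral\<^sup>L lborel g"
proof -
  have gm [measurable]: "g \<in> borel_measurable borel"
    by (rule borel_measurable_LIMSEQ_real[OF lim meas])
  have g0: "0 \<le> g y" and g1: "g y \<le> 1" for y
    using range lim by (auto intro!: LIMSEQ_le_const[OF lim] LIMSEQ_le_const2[OF lim])
  \<comment> \<open>Fatou's lemma carries a uniform tail bound over to the limit, so
    \<open>g\<close> is integrable for the same reason as every \<open>h n\<close>.\<close>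
  have gtail: "(\<integral>\<^sup>+y. ennreal (g y * indicator {y. \<bar>y\<bar> > c} y) \<partial>lborel) \<le> ennreal \<epsilon>"
    if "\<And>n. (\<integral>\<^sup>+y. ennreal (h n y * indicator {y. \<bar>y\<bar> > c} y) \<partial>lborel) \<le> ennreal \<epsilon>" for c \<epsilon>
  proof -
    have "liminf (\<lambda>n. ennreal (h n y * indicator {y. \<bar>y\<bar> > c} y)) = ennreal (g y * indicator {y. \<bar>y\<bar> > c} y)" for y
      by (intro lim_imp_Liminf tendsto_ennrealI tendsto_mult lim tendsto_const) simp
    then have "(\<integral>\<^sup>+y. ennreal (g y * indicator {y. \<bar>y\<bar> > c} y) \<partial>lborel) =
        (\<integral>\<^sup>+y. liminf (\<lambda>n. ennreal (h n y * indicator {y. \<bar>y\<bar> > c} y)) \<partial>lborel)"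
      by simp
    also have "\<dots> \<le> liminf (\<lambda>n. \<integral>\<^sup>+y. ennreal (h n y * indicator {y. \<bar>y\<bar> > c} y) \<partial>lborel)"
      by (rule nn_integral_liminf) measurable
    also have "\<dots> \<le> limsup (\<lambda>n. \<integral>\<^sup>+y. ennreal (h n y * indicator {y. \<bar>y\<bar> > c} y) \<partial>lborel)"
      by (rule Liminf_le_Limsup) simp
    also have "\<dots> \<le> ennreal \<epsilon>"
      by (rule Limsup_bounded) (use that in auto)
    finally show ?thesis .
  qed
  \<comment> \<open>One finite tail is enough: on the remaining bounded interval the function is
    dominated by 1.\<close>
  have int: "integrable lborel f"
    if f: "f \<in> borel_measurable borel" "\<And>y. 0 \<le> f y" "\<And>y. f y \<le> 1"
      "(\<integral>\<^sup>+y. ennreal (f y * indicator {y. \<bar>y\<bar> > c} y) \<partial>lborel) \<le> ennreal \<epsilon>" for f :: "real \<Rightarrow> real" and c \<epsilon> :: real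
  proof (rule integrableI_bounded)
    show "f \<in> borel_measurable lborel" using f(1) by simp
    note [measurable] = f(1)
    have "(\<integral>\<^sup>+y. norm (f y) \<partial>lborel) \<le>
        (\<integral>\<^sup>+y. indicator {-c..c} y + ennreal (f y * indicator {y. \<bar>y\<bar> > c} y) \<partial>lborel)"
    proof (intro nn_integral_mono)
      fix y
      show "ennreal (norm (f y)) \<le> indicator {-c..c} y + ennreal (f y * indicator {y. \<bar>y\<bar> > c} y)"
      proof (cases "\<bar>y\<bar> > c")
        case False
        then have "y \<in> {-c..c}" by auto
        with False show ?thesis using f(2,3)[of y] by (simp add: ennreal_le_1)
      qed (use f(2)[of y] in auto)
    qed
    also have "\<dots> = emeasure lborel {-c..c} + (\<integral>\<^sup>+y. ennreal (f y * indicator {y. \<bar>y\<bar> > c} y) \<partial>lborel)"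
      by (subst nn_integral_add) auto
    also have "\<dots> < \<infinity>"
      using f(4) by (auto simp: emeasure_lborel_Icc_eq ennreal_add_eq_top less_top[symmetric] top_unique)
    finally show "(\<integral>\<^sup>+y. norm (f y) \<partial>lborel) < \<infinity>" .
  qed
  obtain c1 where c1: "\<And>n. (\<integral>\<^sup>+y. ennreal (h n y * indicator {y. \<bar>y\<bar> > c1} y) \<partial>lborel) \<le> ennreal 1"
    using tail[of 1] by auto
  show hint: "integrable lborel (h n)" for n
    by (rule int[OF meas range c1])
  show gint: "integrable lborel g"
    by (rule int[OF gm g0 g1 gtail[OF c1]])
  show "(\<lambda>n. integral\<^sup>L lborel (h n)) \<longlonglongrightarrow> integral\<^sup>L lborel g"
  proof (rule LIMSEQ_I)
    fix r :: real assume "r > 0"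
    define \<epsilon> where "\<epsilon> = r / 4"
    have \<epsilon>: "\<epsilon> > 0" using \<open>r > 0\<close> by (simp add: \<epsilon>_def)
    obtain c where c: "\<And>n. (\<integral>\<^sup>+y. ennreal (h n y * indicator {y. \<bar>y\<bar> > c} y) \<partial>lborel) \<le> ennreal \<epsilon>"
      using tail[OF \<epsilon>] by auto
    \<comment> \<open>The constant 1 is not integrable on the line, so dominated convergence is used
      on \<open>{-c..c}\<close> only; both tails lie in [0, \<epsilon>].\<close>
    have spl: "integral\<^sup>L lborel f = (\<integral>y. f y * indicator {-c..c} y \<partial>lborel)
        + (\<integral>y. f y * indicator {y. \<bar>y\<bar> > c} y \<partial>lborel)" (is ?A)
      and bd: "0 \<le> (\<integral>y. f y * indicator {y. \<bar>y\<bar> > c} y \<partial>lborel)"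
        "(\<integral>y. f y * indicator {y. \<bar>y\<bar> > c} y \<partial>lborel) \<le> \<epsilon>"
      if f: "integrable lborel f" "\<And>y. 0 \<le> f y"
        "(\<integral>\<^sup>+y. ennreal (f y * indicator {y. \<bar>y\<bar> > c} y) \<partial>lborel) \<le> ennreal \<epsilon>" for f
    proof -
      have i: "integrable lborel (\<lambda>y. f y * indicator {-c..c} y)"
        "integrable lborel (\<lambda>y. f y * indicator {y. \<bar>y\<bar> > c} y)"
        by (auto intro!: integrable_real_mult_indicator f simp: mult.commute)
      show ?A
        by (subst Bochner_Integration.integral_add[symmetric, OF i], rule Bochner_Integration.integral_cong)
          (auto split: split_indicator)
      show "0 \<le> (\<integral>y. f y * indicator {y. \<bar>y\<bar> > c} y \<partial>lborel)"
        using f by (auto intro!: integral_nonneg_AE)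
      then show "(\<integral>y. f y * indicator {y. \<bar>y\<bar> > c} y \<partial>lborel) \<le> \<epsilon>"
        using f(3) \<epsilon> f(2) by (subst (asm) nn_integral_eq_integral[OF i(2)]) auto
    qed
    have "(\<lambda>n. \<integral>y. h n y * indicator {-c..c} y \<partial>lborel) \<longlonglongrightarrow> (\<integral>y. g y * indicator {-c..c} y \<partial>lborel)"
    proof (rule integral_dominated_convergence[where w="indicator {-c..c}"])
      show "integrable lborel (indicator {-c..c} :: real \<Rightarrow> real)"
        by (simp add: emeasure_lborel_Icc_eq)
      show "AE y in lborel. (\<lambda>n. h n y * indicator {-c..c} y) \<longlonglongrightarrow> g y * indicator {-c..c} y"
        by (intro AE_I2 tendsto_mult lim tendsto_const)
      show "AE y in lborel. norm (h n y * indicator {-c..c} y) \<le> indicator {-c..c} y" for n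
        using range by (auto split: split_indicator)
    qed measurable
    from LIMSEQ_D[OF this \<epsilon>] obtain N where N: "\<And>n. n \<ge> N \<Longrightarrow>
       \<bar>(\<integral>y. h n y * indicator {-c..c} y \<partial>lborel) - (\<integral>y. g y * indicator {-c..c} y \<partial>lborel)\<bar> < \<epsilon>"
      by (auto simp: real_norm_def)
    show "\<exists>N. \<forall>n\<ge>N. norm (integral\<^sup>L lborel (h n) - integral\<^sup>L lborel g) < r"
    proof (intro exI allI impI)
      fix n assume "n \<ge> N"
      from N[OF this] spl[OF hint range(1) c, of n] bd[OF hint range(1) c, of n]
        spl[OF gint g0 gtail[OF c]] bd[OF gint g0 gtail[OF c]]
      show "norm (integral\<^sup>L lborel (h n) - integral\<^sup>L lborel g) < r"
        using \<open>r > 0\<close> unfolding real_norm_def \<epsilon>_def by argo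
    qed
  qed
qed

text \<open>The sides of \<open>expectile_eq\<close> are extended nonnegative reals and cannot be
  subtracted; this is their real-valued difference. For Z with distribution function
  \<open>D\<close> and finite mean it is \<alpha> E(Z - t)^+ - (1 - \<alpha>) E(t - Z)^+.\<close>

definition expectile_fun :: "real \<Rightarrow> (real \<Rightarrow> real) \<Rightarrow> real \<Rightarrow> real" where
  "expectile_fun \<alpha> D t = \<alpha> * (\<integral>y. (1 - D y) * indicator {t..} y \<partial>lborel)
     - (1 - \<alpha>) * (\<integral>y. D y * indicator {..t} y \<partial>lborel)"

text \<open>For a distribution function the two integrability conditions say that the first moment
  is finite. Range and integrability are also what a pointwise limit inherits through
  \<open>Vitali_tails\<close>.\<close>

locale finite_mean_df =
  fixes D :: "real \<Rightarrow> real"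
  assumes nonneg: "\<And>y. 0 \<le> D y" and le_1: "\<And>y. D y \<le> 1"
    and int_upper: "\<And>t. integrable lborel (\<lambda>y. (1 - D y) * indicator {t..} y)"
    and int_lower: "\<And>t. integrable lborel (\<lambda>y. D y * indicator {..t} y)"
begin

lemma expectile_eq_iff:
  assumes "0 \<le> \<alpha>" "\<alpha> \<le> 1"
  shows "expectile_eq \<alpha> D t \<longleftrightarrow> expectile_fun \<alpha> D t = 0"
proof -
  have 1: "(\<integral>\<^sup>+ y. ennreal (1 - D y) * indicator {t..} y \<partial>lborel) =
      ennreal (\<integral>y. (1 - D y) * indicator {t..} y \<partial>lborel)"
    using nonneg le_1
    by (subst nn_integral_eq_integral[symmetric, OF int_upper])
      (auto intro!: nn_integral_cong split: split_indicator)
  have 2: "(\<integral>\<^sup>+ y. ennreal (D y) * indicator {..t} y \<partial>lborel) =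
      ennreal (\<integral>y. D y * indicator {..t} y \<partial>lborel)"
    using nonneg le_1
    by (subst nn_integral_eq_integral[symmetric, OF int_lower])
      (auto intro!: nn_integral_cong split: split_indicator)
  have "0 \<le> (\<integral>y. (1 - D y) * indicator {t..} y \<partial>lborel)" "0 \<le> (\<integral>y. D y * indicator {..t} y \<partial>lborel)"
    using nonneg le_1 by (auto intro!: integral_nonneg_AE)
  then show ?thesis
    unfolding expectile_eq_def expectile_fun_def 1 2 using assms
    by (simp flip: ennreal_mult)
qed

text \<open>Between s and t the integrands differ by \<alpha> (1 - D) + (1 - \<alpha>) D, a convex
  combination of \<alpha> and 1 - \<alpha>. For s < t only one of the two terms survives at each
  endpoint, hence the open interval in the lower bound and the closed one in the upper
  bound.\<close>

lemma expectile_fun_slope: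
  assumes "0 \<le> \<alpha>" "\<alpha> \<le> 1" "s \<le> t"
  shows "min \<alpha> (1 - \<alpha>) * (t - s) \<le> expectile_fun \<alpha> D s - expectile_fun \<alpha> D t"
    and "expectile_fun \<alpha> D s - expectile_fun \<alpha> D t \<le> t - s"
proof -
  define \<psi> where "\<psi> t y = \<alpha> * ((1 - D y) * indicator {t..} y) - (1 - \<alpha>) * (D y * indicator {..t} y)" for t y
  have i: "integrable lborel (\<psi> t)" for t
    unfolding \<psi>_def by (intro Bochner_Integration.integrable_diff integrable_mult_right int_upper int_lower)
  have e: "expectile_fun \<alpha> D t = integral\<^sup>L lborel (\<psi> t)" for t
    unfolding expectile_fun_def \<psi>_def
    by (subst Bochner_Integration.integral_diff)
      (auto intro!: integrable_mult_right int_upper int_lower)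
  have d: "expectile_fun \<alpha> D s - expectile_fun \<alpha> D t = (\<integral>y. \<psi> s y - \<psi> t y \<partial>lborel)"
    unfolding e by (simp add: i)
  have "min \<alpha> (1 - \<alpha>) * (t - s) = (\<integral>y. min \<alpha> (1 - \<alpha>) * indicator {s<..<t} y \<partial>lborel)"
    using assms by simp
  also have "\<dots> \<le> (\<integral>y. \<psi> s y - \<psi> t y \<partial>lborel)"
  proof (rule integral_mono)
    fix y
    have "min \<alpha> (1-\<alpha>) * (1 - D y) \<le> \<alpha> * (1 - D y)" "min \<alpha> (1-\<alpha>) * D y \<le> (1-\<alpha>) * D y"
      "0 \<le> \<alpha> * (1 - D y)" "0 \<le> (1-\<alpha>) * D y"
      using nonneg[of y] le_1[of y] assms by (auto intro!: mult_right_mono)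
    then show "min \<alpha> (1 - \<alpha>) * indicator {s<..<t} y \<le> \<psi> s y - \<psi> t y"
      using assms unfolding \<psi>_def
      by (auto split: split_indicator simp: algebra_simps)
  qed (use assms in \<open>auto intro!: i Bochner_Integration.integrable_diff\<close>)
  finally show "min \<alpha> (1 - \<alpha>) * (t - s) \<le> expectile_fun \<alpha> D s - expectile_fun \<alpha> D t"
    unfolding d .
  have "(\<integral>y. \<psi> s y - \<psi> t y \<partial>lborel) \<le> (\<integral>y. indicator {s..t} y \<partial>lborel)"
  proof (rule integral_mono)
    fix y
    have "\<alpha> * (1 - D y) \<le> 1 - D y" "(1-\<alpha>) * D y \<le> D y"
      "0 \<le> \<alpha> * (1 - D y)" "0 \<le> (1-\<alpha>) * D y"
      using nonneg[of y] le_1[of y] assms by (auto intro!: mult_left_le_one_le)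
    then show "\<psi> s y - \<psi> t y \<le> indicator {s..t} y"
      using assms nonneg[of y] le_1[of y] unfolding \<psi>_def
      by (auto split: split_indicator)
  qed (use assms in \<open>auto intro!: i Bochner_Integration.integrable_diff simp: emeasure_lborel_Icc_eq\<close>)
  also have "\<dots> = t - s" using assms by simp
  finally show "expectile_fun \<alpha> D s - expectile_fun \<alpha> D t \<le> t - s"
    unfolding d .
qed

text \<open>Gives the definite descriptions of expectiles their meaning: with slopes between -1 and
  \<open>-m\<close> the function is continuous, changes sign and is injective.\<close>

lemma expectile_ex1:
  assumes "0 < \<alpha>" "\<alpha> < 1"
  shows "\<exists>!t. expectile_eq \<alpha> D t"
proof -
  let ?f = "expectile_fun \<alpha> D"
  define m where "m = min \<alpha> (1 - \<alpha>)"
  have m: "m > 0" using assms by (auto simp: m_def)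
  have sl: "m * (t - s) \<le> ?f s - ?f t" "?f s - ?f t \<le> t - s" if "s \<le> t" for s t
    using expectile_fun_slope[of \<alpha> s t] that assms by (simp_all add: m_def)
  have "continuous_on UNIV ?f"
  proof (rule lipschitz_on_continuous_on[of 1], rule lipschitz_onI)
    fix s t :: real
    show "dist (?f s) (?f t) \<le> 1 * dist s t"
    proof (cases "s \<le> t")
      case True
      then have "0 \<le> m * (t - s)" using m by (intro mult_nonneg_nonneg) auto
      moreover have "m * (t - s) \<le> ?f s - ?f t" "?f s - ?f t \<le> t - s"
        using sl[of s t] True assms by auto
      ultimately show ?thesis unfolding dist_real_def mult_1_left abs_le_iff using True by linarith
    next
      case False
      then have "0 \<le> m * (s - t)" using m by (intro mult_nonneg_nonneg) auto
      moreover have "m * (s - t) \<le> ?f t - ?f s" "?f t - ?f s \<le> s - t"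
        using sl[of t s] False assms by auto
      ultimately show ?thesis unfolding dist_real_def mult_1_left abs_le_iff using False by linarith
    qed
  qed simp
  then have c: "continuous_on {a..b} ?f" for a b
    by (rule continuous_on_subset) simp
  \<comment> \<open>Moving by \<open>b\<close> changes the value by at least \<open>m * b\<close>,
    which is the size of \<open>?f 0\<close>, so a zero lies in \<open>{-b..b}\<close>.\<close>
  define b where "b = \<bar>?f 0\<bar> / m"
  have b: "b \<ge> 0" "m * b = \<bar>?f 0\<bar>" using m by (auto simp: b_def)
  have "?f b \<le> 0" "0 \<le> ?f (-b)"
    using sl(1)[of 0 b] sl(1)[of "-b" 0] b assms by auto
  then obtain t where "?f t = 0"
    using IVT2'[of ?f b 0 "-b"] c b by auto
  moreover have "t = t'" if "?f t = 0" "?f t' = 0" for t t'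
  proof (rule ccontr)
    assume "t \<noteq> t'"
    with that sl(1)[of t t'] sl(1)[of t' t] m assms show False
      by (cases "t < t'") (auto simp: mult_le_0_iff)
  qed
  ultimately show ?thesis
    unfolding expectile_eq_iff[OF less_imp_le[OF assms(1)] less_imp_le[OF assms(2)]] by blast
qed

lemma The_expectile_dist:
  assumes "0 < \<alpha>" "\<alpha> < 1"
  shows "min \<alpha> (1 - \<alpha>) * \<bar>(THE t. expectile_eq \<alpha> D t) - e\<bar> \<le> \<bar>expectile_fun \<alpha> D e\<bar>"
proof -
  let ?t = "THE t. expectile_eq \<alpha> D t"
  have "expectile_fun \<alpha> D ?t = 0"
    using theI'[OF expectile_ex1[OF assms]] expectile_eq_iff[of \<alpha>] assms by auto
  then show ?thesis
    using expectile_fun_slope(1)[of \<alpha> ?t e] expectile_fun_slope(1)[of \<alpha> e ?t] assms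
    by (cases "?t \<le> e") auto
qed

end

text \<open>The tail condition is one-sided, above \<open>c\<close> for 1 - D_n and below
  \<open>-c\<close> for D_n, because these are the parts that first moments control. On the opposite
  sides the half-lines \<open>{t..}\<close> and \<open>{..t}\<close> cut the integrands off.\<close>

theorem expectile_tendsto:
  fixes Dn :: "nat \<Rightarrow> real \<Rightarrow> real"
  assumes \<alpha>: "0 < \<alpha>" "\<alpha> < 1"
    and mono: "\<And>n. mono (Dn n)" and range: "\<And>n y. 0 \<le> Dn n y" "\<And>n y. Dn n y \<le> 1"
    and lim: "\<And>y. (\<lambda>n. Dn n y) \<longlonglongrightarrow> D y"
    and tail: "\<And>\<epsilon>. \<epsilon> > 0 \<Longrightarrow> \<exists>c. \<forall>n.
       (\<integral>\<^sup>+y. ennreal ((1 - Dn n y) * indicator {c<..} y) \<partial>lborel) \<le> ennreal \<epsilon> \<and>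
       (\<integral>\<^sup>+y. ennreal (Dn n y * indicator {..<-c} y) \<partial>lborel) \<le> ennreal \<epsilon>"
  shows "(\<lambda>n. THE t. expectile_eq \<alpha> (Dn n) t) \<longlonglongrightarrow> (THE t. expectile_eq \<alpha> D t)"
proof -
  have [measurable]: "Dn n \<in> borel_measurable borel" for n
    by (rule borel_measurable_mono[OF mono])
  have tail_upper: "\<exists>c. \<forall>n. (\<integral>\<^sup>+y. ennreal ((1 - Dn n y) * indicator {t..} y * indicator {y. \<bar>y\<bar> > c} y) \<partial>lborel)
      \<le> ennreal \<epsilon>" if "\<epsilon> > 0" for t \<epsilon>
  proof -
    obtain c where c: "\<And>n. (\<integral>\<^sup>+y. ennreal ((1 - Dn n y) * indicator {c<..} y) \<partial>lborel) \<le> ennreal \<epsilon>"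
      using tail[OF \<open>\<epsilon> > 0\<close>] by auto
    \<comment> \<open>Beyond the maximum of \<open>c\<close> and the modulus of \<open>t\<close>,
      the half-line \<open>{t..}\<close> meets only the upper tail.\<close>
    have "(\<integral>\<^sup>+y. ennreal ((1 - Dn n y) * indicator {t..} y * indicator {y. \<bar>y\<bar> > max c \<bar>t\<bar>} y) \<partial>lborel)
        \<le> (\<integral>\<^sup>+y. ennreal ((1 - Dn n y) * indicator {c<..} y) \<partial>lborel)" for n
      using range by (intro nn_integral_mono) (auto split: split_indicator)
    then show ?thesis using c order_trans by blast
  qed
  have tail_lower: "\<exists>c. \<forall>n. (\<integral>\<^sup>+y. ennreal (Dn n y * indicator {..t} y * indicator {y. \<bar>y\<bar> > c} y) \<partial>lborel)
      \<le> ennreal \<epsilon>" if "\<epsilon> > 0" for t \<epsilon>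
  proof -
    obtain c where c: "\<And>n. (\<integral>\<^sup>+y. ennreal (Dn n y * indicator {..<-c} y) \<partial>lborel) \<le> ennreal \<epsilon>"
      using tail[OF \<open>\<epsilon> > 0\<close>] by auto
    have "(\<integral>\<^sup>+y. ennreal (Dn n y * indicator {..t} y * indicator {y. \<bar>y\<bar> > max c \<bar>t\<bar>} y) \<partial>lborel)
        \<le> (\<integral>\<^sup>+y. ennreal (Dn n y * indicator {..<-c} y) \<partial>lborel)" for n
      using range by (intro nn_integral_mono) (auto split: split_indicator)
    then show ?thesis using c order_trans by blast
  qed
  have upper: "integrable lborel (\<lambda>y. (1 - Dn n y) * indicator {t..} y)"
      "integrable lborel (\<lambda>y. (1 - D y) * indicator {t..} y)"
      "(\<lambda>n. \<integral>y. (1 - Dn n y) * indicator {t..} y \<partial>lborel) \<longlonglongrightarrow> (\<integral>y. (1 - D y) * indicator {t..} y \<partial>lborel)" for n t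
  proof -
    have m: "(\<lambda>y. (1 - Dn n y) * indicator {t..} y) \<in> borel_measurable borel" for n by measurable
    have r: "0 \<le> (1 - Dn n y) * indicator {t..} y" "(1 - Dn n y) * indicator {t..} y \<le> 1" for n y
      using range[of n y] by (auto split: split_indicator)
    have l: "(\<lambda>n. (1 - Dn n y) * indicator {t..} y) \<longlonglongrightarrow> (1 - D y) * indicator {t..} y" for y
      by (intro tendsto_intros lim)
    show "integrable lborel (\<lambda>y. (1 - Dn n y) * indicator {t..} y)"
      by (rule Vitali_tails(1)[OF m r l tail_upper])
    show "integrable lborel (\<lambda>y. (1 - D y) * indicator {t..} y)"
      by (rule Vitali_tails(2)[OF m r l tail_upper])
    show "(\<lambda>n. \<integral>y. (1 - Dn n y) * indicator {t..} y \<partial>lborel) \<longlonglongrightarrow> (\<integral>y. (1 - D y) * indicator {t..} y \<partial>lborel)"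
      by (rule Vitali_tails(3)[OF m r l tail_upper])
  qed
  have lower: "integrable lborel (\<lambda>y. Dn n y * indicator {..t} y)"
      "integrable lborel (\<lambda>y. D y * indicator {..t} y)"
      "(\<lambda>n. \<integral>y. Dn n y * indicator {..t} y \<partial>lborel) \<longlonglongrightarrow> (\<integral>y. D y * indicator {..t} y \<partial>lborel)" for n t
  proof -
    have m: "(\<lambda>y. Dn n y * indicator {..t} y) \<in> borel_measurable borel" for n by measurable
    have r: "0 \<le> Dn n y * indicator {..t} y" "Dn n y * indicator {..t} y \<le> 1" for n y
      using range[of n y] by (auto split: split_indicator)
    have l: "(\<lambda>n. Dn n y * indicator {..t} y) \<longlonglongrightarrow> D y * indicator {..t} y" for y
      by (intro tendsto_intros lim)
    show "integrable lborel (\<lambda>y. Dn n y * indicator {..t} y)"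
      by (rule Vitali_tails(1)[OF m r l tail_lower])
    show "integrable lborel (\<lambda>y. D y * indicator {..t} y)"
      by (rule Vitali_tails(2)[OF m r l tail_lower])
    show "(\<lambda>n. \<integral>y. Dn n y * indicator {..t} y \<partial>lborel) \<longlonglongrightarrow> (\<integral>y. D y * indicator {..t} y \<partial>lborel)"
      by (rule Vitali_tails(3)[OF m r l tail_lower])
  qed
  interpret n: finite_mean_df "Dn n" for n
    using range upper lower by unfold_locales auto
  interpret finite_mean_df D
    by unfold_locales
      (use range lim upper lower in \<open>auto intro!: LIMSEQ_le_const[OF lim] LIMSEQ_le_const2[OF lim]\<close>)
  let ?e = "THE t. expectile_eq \<alpha> D t"
  define m where "m = min \<alpha> (1 - \<alpha>)"
  have m: "m > 0" using \<alpha> by (simp add: m_def)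
  have dist: "\<bar>(THE t. expectile_eq \<alpha> (Dn n) t) - ?e\<bar> \<le> \<bar>expectile_fun \<alpha> (Dn n) ?e\<bar> / m" for n
    using n.The_expectile_dist[OF \<alpha>, of n ?e] m by (simp add: m_def[symmetric] field_simps)
  have "expectile_fun \<alpha> D ?e = 0"
    using theI'[OF expectile_ex1[OF \<alpha>]] expectile_eq_iff[of \<alpha>] \<alpha> by auto
  moreover have "(\<lambda>n. expectile_fun \<alpha> (Dn n) ?e) \<longlonglongrightarrow> expectile_fun \<alpha> D ?e"
    unfolding expectile_fun_def by (intro tendsto_intros upper lower)
  ultimately have "(\<lambda>n. \<bar>expectile_fun \<alpha> (Dn n) ?e\<bar> / m) \<longlonglongrightarrow> 0"
    by (intro tendsto_divide_zero tendsto_rabs_zero) simp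
  then have "(\<lambda>n. (THE t. expectile_eq \<alpha> (Dn n) t) - ?e) \<longlonglongrightarrow> 0"
    by (rule Lim_null_comparison[rotated]) (use dist in simp)
  then show ?thesis by (rule LIM_zero_cancel)
qed

section \<open>Tail integrals of a distribution function against truncated first moments\<close>

context
  fixes D :: "real \<Rightarrow> real"
  assumes mono: "mono D" and right_cont: "\<And>a. continuous (at_right a) D"
    and lim_bot: "(D \<longlongrightarrow> 0) at_bot" and lim_top: "(D \<longlongrightarrow> 1) at_top"
begin

lemma real_distribution_df: "real_distribution (interval_measure D)"
  using mono right_cont lim_bot lim_top
  by (intro real_distribution_interval_measure) (auto dest: monoD)

lemma df_eq_measure: "measure (interval_measure D) {..y} = D y"
  using mono right_cont lim_bot lim_top
  by (intro measure_interval_measure_Iic) (auto dest: monoD)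

lemma df_bounds: "0 \<le> D y" "D y \<le> 1"
proof -
  interpret real_distribution "interval_measure D" by (rule real_distribution_df)
  show "0 \<le> D y" "D y \<le> 1"
    using df_eq_measure[of y] measure_nonneg[of "interval_measure D" "{..y}"] prob_le_1[of "{..y}"] by auto
qed

text \<open>Layer-cake formula: 1 - D y is the probability of Z > y, so by Fubini the left side is
  E(Z - c)^+. For c \<ge> 0 the integrand is at most the modulus of Z and vanishes unless Z >
  c.\<close>

lemma df_upper_tail_le:
  assumes "0 \<le> c"
  shows "(\<integral>\<^sup>+y. ennreal ((1 - D y) * indicator {c<..} y) \<partial>lborel) \<le>
    (\<integral>\<^sup>+z. ennreal \<bar>z\<bar> * indicator {z. c \<le> \<bar>z\<bar>} z \<partial>interval_measure D)"
proof -
  let ?P = "interval_measure D"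
  interpret real_distribution ?P by (rule real_distribution_df)
  interpret pair_sigma_finite ?P lborel ..
  have "ennreal ((1 - D y) * indicator {c<..} y) =
      (\<integral>\<^sup>+z. indicator {(z, y). y < z \<and> c < y} (z, y) \<partial>?P)" for y
  proof -
    have "1 - D y = prob (UNIV - {..y})"
      using prob_compl[of "{..y}"] by (simp add: df_eq_measure)
    also have "UNIV - {..y} = {y<..}" by auto
    finally have "ennreal (1 - D y) = emeasure ?P {y<..}"
      by (simp add: emeasure_eq_measure)
    moreover have "(\<integral>\<^sup>+z. indicator {(z, y). y < z \<and> c < y} (z, y) \<partial>?P) =
        (\<integral>\<^sup>+z. indicator {y<..} z * indicator {c<..} y \<partial>?P)"
      by (intro nn_integral_cong) (auto split: split_indicator)
    ultimately show ?thesis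
      by (auto simp: nn_integral_multc split: split_indicator)
  qed
  then have "(\<integral>\<^sup>+y. ennreal ((1 - D y) * indicator {c<..} y) \<partial>lborel) =
      (\<integral>\<^sup>+y. \<integral>\<^sup>+z. indicator {(z, y). y < z \<and> c < y} (z, y) \<partial>?P \<partial>lborel)"
    by simp
  also have "\<dots> = (\<integral>\<^sup>+z. \<integral>\<^sup>+y. indicator {(z, y). y < z \<and> c < y} (z, y) \<partial>lborel \<partial>?P)"
    by (intro Fubini') measurable
  also have "\<dots> \<le> (\<integral>\<^sup>+z. ennreal \<bar>z\<bar> * indicator {z. c \<le> \<bar>z\<bar>} z \<partial>?P)"
  proof (rule nn_integral_mono)
    fix z :: real
    have "(\<integral>\<^sup>+y. indicator {(z, y). y < z \<and> c < y} (z, y) \<partial>lborel) =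
        (\<integral>\<^sup>+y. indicator {c<..<z} y \<partial>lborel)"
      by (intro nn_integral_cong) (auto split: split_indicator)
    also have "\<dots> = emeasure lborel {c<..<z}" by simp
    also have "\<dots> \<le> ennreal \<bar>z\<bar> * indicator {z. c \<le> \<bar>z\<bar>} z"
      using assms by (cases "c \<le> z") (auto intro!: ennreal_leI)
    finally show "(\<integral>\<^sup>+y. indicator {(z, y). y < z \<and> c < y} (z, y) \<partial>lborel) \<le>
        ennreal \<bar>z\<bar> * indicator {z. c \<le> \<bar>z\<bar>} z" .
  qed
  finally show ?thesis .
qed

text \<open>Mirror image of the upper tail: the left side is E(-c - Z)^+.\<close>

lemma df_lower_tail_le:
  assumes "0 \<le> c"
  shows "(\<integral>\<^sup>+y. ennreal (D y * indicator {..<-c} y) \<partial>lborel) \<le>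
    (\<integral>\<^sup>+z. ennreal \<bar>z\<bar> * indicator {z. c \<le> \<bar>z\<bar>} z \<partial>interval_measure D)"
proof -
  let ?P = "interval_measure D"
  interpret real_distribution ?P by (rule real_distribution_df)
  interpret pair_sigma_finite ?P lborel ..
  have "ennreal (D y * indicator {..<-c} y) =
      (\<integral>\<^sup>+z. indicator {(z, y). z \<le> y \<and> y < -c} (z, y) \<partial>?P)" for y
  proof -
    have "ennreal (D y) = emeasure ?P {..y}"
      by (simp add: emeasure_eq_measure df_eq_measure)
    moreover have "(\<integral>\<^sup>+z. indicator {(z, y). z \<le> y \<and> y < -c} (z, y) \<partial>?P) =
        (\<integral>\<^sup>+z. indicator {..y} z * indicator {..<-c} y \<partial>?P)"
      by (intro nn_integral_cong) (auto split: split_indicator)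
    ultimately show ?thesis
      by (auto simp: nn_integral_multc split: split_indicator)
  qed
  then have "(\<integral>\<^sup>+y. ennreal (D y * indicator {..<-c} y) \<partial>lborel) =
      (\<integral>\<^sup>+y. \<integral>\<^sup>+z. indicator {(z, y). z \<le> y \<and> y < -c} (z, y) \<partial>?P \<partial>lborel)"
    by simp
  also have "\<dots> = (\<integral>\<^sup>+z. \<integral>\<^sup>+y. indicator {(z, y). z \<le> y \<and> y < -c} (z, y) \<partial>lborel \<partial>?P)"
    by (intro Fubini') measurable
  also have "\<dots> \<le> (\<integral>\<^sup>+z. ennreal \<bar>z\<bar> * indicator {z. c \<le> \<bar>z\<bar>} z \<partial>?P)"
  proof (rule nn_integral_mono)
    fix z :: real
    have "(\<integral>\<^sup>+y. indicator {(z, y). z \<le> y \<and> y < -c} (z, y) \<partial>lborel) =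
        (\<integral>\<^sup>+y. indicator {z..<-c} y \<partial>lborel)"
      by (intro nn_integral_cong) (auto split: split_indicator)
    also have "\<dots> = emeasure lborel {z..<-c}" by simp
    also have "\<dots> \<le> ennreal \<bar>z\<bar> * indicator {z. c \<le> \<bar>z\<bar>} z"
      using assms by (cases "z \<le> -c") (auto intro!: ennreal_leI)
    finally show "(\<integral>\<^sup>+y. indicator {(z, y). z \<le> y \<and> y < -c} (z, y) \<partial>lborel) \<le>
        ennreal \<bar>z\<bar> * indicator {z. c \<le> \<bar>z\<bar>} z" .
  qed
  finally show ?thesis .
qed

end

lemma unif_integrable_dfs_tails:
  assumes df: "\<And>n. n \<ge> 1 \<Longrightarrow> mono (D n)" "\<And>n a. n \<ge> 1 \<Longrightarrow> continuous (at_right a) (D n)"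
      "\<And>n. n \<ge> 1 \<Longrightarrow> (D n \<longlongrightarrow> 0) at_bot" "\<And>n. n \<ge> 1 \<Longrightarrow> (D n \<longlongrightarrow> 1) at_top"
    and ui: "unif_integrable_dfs D" and "0 < \<epsilon>"
  shows "\<exists>c. \<forall>n\<ge>1. (\<integral>\<^sup>+y. ennreal ((1 - D n y) * indicator {c<..} y) \<partial>lborel) \<le> ennreal \<epsilon> \<and>
       (\<integral>\<^sup>+y. ennreal (D n y * indicator {..<-c} y) \<partial>lborel) \<le> ennreal \<epsilon>"
proof -
  obtain c where c: "\<forall>n\<ge>1. (\<integral>\<^sup>+ z. ennreal \<bar>z\<bar> * indicator {z. c \<le> \<bar>z\<bar>} z \<partial>interval_measure (D n)) < ennreal \<epsilon>"
    using ui[unfolded unif_integrable_dfs_def, rule_format, OF \<open>0 < \<epsilon>\<close>] ..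
  show ?thesis
  \<comment> \<open>The cutoff supplied by uniform integrability may be negative; raising it to 0
    only shrinks the truncated moment.\<close>
  proof (intro exI[of _ "max c 0"] allI impI)
    fix n :: nat assume n: "n \<ge> 1"
    have "(\<integral>\<^sup>+ z. ennreal \<bar>z\<bar> * indicator {z. max c 0 \<le> \<bar>z\<bar>} z \<partial>interval_measure (D n)) \<le>
      (\<integral>\<^sup>+ z. ennreal \<bar>z\<bar> * indicator {z. c \<le> \<bar>z\<bar>} z \<partial>interval_measure (D n))"
      by (intro nn_integral_mono) (auto split: split_indicator)
    also have "\<dots> \<le> ennreal \<epsilon>"
      using c n by (simp add: less_imp_le)
    finally have le: "(\<integral>\<^sup>+ z. ennreal \<bar>z\<bar> * indicator {z. max c 0 \<le> \<bar>z\<bar>} z \<partial>interval_measure (D n)) \<le> ennreal \<epsilon>" .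
    note tails = df_upper_tail_le[OF df[OF n] max.cobounded2] df_lower_tail_le[OF df[OF n] max.cobounded2]
    show "(\<integral>\<^sup>+y. ennreal ((1 - D n y) * indicator {max c 0<..} y) \<partial>lborel) \<le> ennreal \<epsilon> \<and>
       (\<integral>\<^sup>+y. ennreal (D n y * indicator {..<-max c 0} y) \<partial>lborel) \<le> ennreal \<epsilon>"
      using order_trans[OF tails(1) le] order_trans[OF tails(2) le] by (rule conjI)
  qed
qed

section \<open>Copula measures\<close>

text \<open>For negative arguments the rectangle is empty; at 0 it lies in a line, which is null by
  the marginal condition.\<close>

lemma copula_of_nonpos: 
  assumes "doubly_stochastic \<mu>" "u \<le> 0 \<or> v \<le> 0"
  shows "copula_of \<mu> u v = 0"
proof -
  interpret prob_space \<mu> using assms by (simp add: doubly_stochastic_def)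
  have S: "sets \<mu> = sets borel" using assms by (simp add: doubly_stochastic_def)
  have Z: "measure \<mu> ({0..0} \<times> UNIV) = 0" "measure \<mu> (UNIV \<times> {0..0}) = 0"
    using assms(1) unfolding doubly_stochastic_def by (metis atLeastAtMost_iff order_refl zero_le_one)+
  have "measure \<mu> ({0..u} \<times> {0..v}) \<le> measure \<mu> ({0..0} \<times> UNIV)" if "u \<le> 0"
    using that by (intro finite_measure_mono) (auto simp: S borel_prod[symmetric])
  moreover have "measure \<mu> ({0..u} \<times> {0..v}) \<le> measure \<mu> (UNIV \<times> {0..0})" if "v \<le> 0"
    using that by (intro finite_measure_mono) (auto simp: S borel_prod[symmetric])
  ultimately show ?thesis
    using assms(2) Z unfolding copula_of_def by (auto simp: measure_le_0_iff)
qed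

locale copula_measure =
  fixes \<mu> :: "(real \<times> real) measure"
  assumes ds: "doubly_stochastic \<mu>"

sublocale copula_measure \<subseteq> prob_space \<mu>
  using ds by (simp add: doubly_stochastic_def)

context copula_measure
begin

lemma sets_eq [measurable_cong]: "sets \<mu> = sets (borel \<Otimes>\<^sub>M borel)"
  using ds by (simp add: doubly_stochastic_def borel_prod[symmetric])

lemma measure_strip:
  "0 \<le> a \<Longrightarrow> a \<le> 1 \<Longrightarrow> measure \<mu> ({0..a} \<times> UNIV) = a"
  "0 \<le> a \<Longrightarrow> a \<le> 1 \<Longrightarrow> measure \<mu> (UNIV \<times> {0..a}) = a"
  using ds by (auto simp: doubly_stochastic_def)

lemma AE_unit: "AE p in \<mu>. p \<in> {0..1} \<times> {0..1}"
  using ds AE_prob_1[of "{0..1} \<times> {0..1}"] by (simp add: doubly_stochastic_def measure_def)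

text \<open>Copula measures live on the Borel sets of the whole plane but are carried by the unit
  square, so only the trace on the square matters.\<close>

lemma measure_cong_unit:
  assumes "S \<in> sets \<mu>" "T \<in> sets \<mu>" "S \<inter> {0..1} \<times> {0..1} = T \<inter> {0..1} \<times> {0..1}"
  shows "measure \<mu> S = measure \<mu> T"
  by (intro finite_measure_eq_AE assms eventually_mono[OF AE_unit]) (use assms(3) in blast)

lemma copula_of_1:
  assumes "0 \<le> u" "u \<le> 1"
  shows "copula_of \<mu> u 1 = u" "copula_of \<mu> 1 u = u"
proof -
  have "measure \<mu> ({0..u} \<times> {0..1}) = measure \<mu> ({0..u} \<times> UNIV)"
    "measure \<mu> ({0..1} \<times> {0..u}) = measure \<mu> (UNIV \<times> {0..u})"
    using assms by (intro measure_cong_unit; force simp: sets_eq)+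
  then show "copula_of \<mu> u 1 = u" "copula_of \<mu> 1 u = u"
    using measure_strip[of u] assms by (simp_all add: copula_of_def)
qed

lemma measure_Ioc_Icc:
  assumes "a \<le> b"
  shows "measure \<mu> ({a<..b} \<times> {0..v}) = copula_of \<mu> b v - copula_of \<mu> a v"
proof (cases "a < 0")
  case True
  then have "copula_of \<mu> a v = 0" by (intro copula_of_nonpos ds) auto
  moreover have "measure \<mu> ({a<..b} \<times> {0..v}) = copula_of \<mu> b v"
    unfolding copula_of_def using True by (intro measure_cong_unit) auto
  ultimately show ?thesis by simp
next
  case False
  then have "{0..b} \<times> {0..v} = {0..a} \<times> {0..v} \<union> {a<..b} \<times> {0..v}"
    using assms by auto
  then have "copula_of \<mu> b v = measure \<mu> ({0..a} \<times> {0..v} \<union> {a<..b} \<times> {0..v})"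
    by (simp add: copula_of_def)
  also have "\<dots> = copula_of \<mu> a v + measure \<mu> ({a<..b} \<times> {0..v})"
    unfolding copula_of_def by (intro finite_measure_Union) (auto simp: sets_eq)
  finally show ?thesis by simp
qed

lemma measure_Icc_Ioc:
  assumes "a \<le> b"
  shows "measure \<mu> ({0..u} \<times> {a<..b}) = copula_of \<mu> u b - copula_of \<mu> u a"
proof (cases "a < 0")
  case True
  then have "copula_of \<mu> u a = 0" by (intro copula_of_nonpos ds) auto
  moreover have "measure \<mu> ({0..u} \<times> {a<..b}) = copula_of \<mu> u b"
    unfolding copula_of_def using True by (intro measure_cong_unit) auto
  ultimately show ?thesis by simp
next
  case False
  then have "{0..u} \<times> {0..b} = {0..u} \<times> {0..a} \<union> {0..u} \<times> {a<..b}"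
    using assms by auto
  then have "copula_of \<mu> u b = measure \<mu> ({0..u} \<times> {0..a} \<union> {0..u} \<times> {a<..b})"
    by (simp add: copula_of_def)
  also have "\<dots> = copula_of \<mu> u a + measure \<mu> ({0..u} \<times> {a<..b})"
    unfolding copula_of_def by (intro finite_measure_Union) (auto simp: sets_eq)
  finally show ?thesis by simp
qed

text \<open>An increment is the mass of a part of a strip, and the whole strip has mass
  \<open>b - a\<close> by the uniform marginals.\<close>

lemma copula_of_increment:
  assumes "0 \<le> a" "a \<le> b" "b \<le> 1"
  shows "0 \<le> copula_of \<mu> b v - copula_of \<mu> a v" "copula_of \<mu> b v - copula_of \<mu> a v \<le> b - a"
    and "0 \<le> copula_of \<mu> u b - copula_of \<mu> u a" "copula_of \<mu> u b - copula_of \<mu> u a \<le> b - a"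
proof -
  have "measure \<mu> ({a<..b} \<times> {0..v}) \<le> measure \<mu> ({a<..b} \<times> UNIV)"
    by (intro finite_measure_mono) (auto simp: sets_eq)
  also have "\<dots> = measure \<mu> ({a<..b} \<times> {0..1})"
    by (intro measure_cong_unit) (auto simp: sets_eq)
  finally show "0 \<le> copula_of \<mu> b v - copula_of \<mu> a v" "copula_of \<mu> b v - copula_of \<mu> a v \<le> b - a"
    using assms measure_nonneg[of \<mu> "{a<..b} \<times> {0..v}"] by (auto simp: measure_Ioc_Icc copula_of_1)
  have "measure \<mu> ({0..u} \<times> {a<..b}) \<le> measure \<mu> (UNIV \<times> {a<..b})"
    by (intro finite_measure_mono) (auto simp: sets_eq)
  also have "\<dots> = measure \<mu> ({0..1} \<times> {a<..b})"
    by (intro measure_cong_unit) (auto simp: sets_eq)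
  finally show "0 \<le> copula_of \<mu> u b - copula_of \<mu> u a" "copula_of \<mu> u b - copula_of \<mu> u a \<le> b - a"
    using assms measure_nonneg[of \<mu> "{0..u} \<times> {a<..b}"] by (auto simp: measure_Icc_Ioc copula_of_1)
qed

lemma copula_of_Lipschitz:
  assumes "u \<in> {0..1}" "u' \<in> {0..1}" "v \<in> {0..1}" "v' \<in> {0..1}"
  shows "\<bar>copula_of \<mu> u v - copula_of \<mu> u' v'\<bar> \<le> \<bar>u - u'\<bar> + \<bar>v - v'\<bar>"
proof -
  have "\<bar>copula_of \<mu> u v - copula_of \<mu> u' v\<bar> \<le> \<bar>u - u'\<bar>"
    using copula_of_increment(1,2)[of u u' v] copula_of_increment(1,2)[of u' u v] assms
    by (cases "u \<le> u'") auto
  moreover have "\<bar>copula_of \<mu> u' v - copula_of \<mu> u' v'\<bar> \<le> \<bar>v - v'\<bar>"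
    using copula_of_increment(3,4)[of v v' u'] copula_of_increment(3,4)[of v' v u'] assms
    by (cases "v \<le> v'") auto
  ultimately show ?thesis by linarith
qed

text \<open>Clipping is done at 1 only: for a negative bound both the trace of the quadrant on the
  unit square and the rectangle of \<open>copula_of\<close> are empty.\<close>

lemma measure_quadrant: "measure \<mu> ({..a} \<times> {..b}) = copula_of \<mu> (min a 1) (min b 1)"
  unfolding copula_of_def by (intro measure_cong_unit) (auto simp: sets_eq)

end

text \<open>Quadrants form an intersection-stable generator of the Borel sets, and their masses are
  values of the copula. This is the uniqueness half of evaluating \<open>mu_of\<close>.\<close>

lemma doubly_stochastic_unique:
  assumes \<mu>: "doubly_stochastic \<mu>" and \<nu>: "doubly_stochastic \<nu>"
    and eq: "\<And>u v. u \<in> {0..1} \<Longrightarrow> v \<in> {0..1} \<Longrightarrow> copula_of \<mu> u v = copula_of \<nu> u v"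
  shows "\<mu> = \<nu>"
proof -
  interpret \<mu>: copula_measure \<mu> by unfold_locales fact
  interpret \<nu>: copula_measure \<nu> by unfold_locales fact
  have eq': "copula_of \<mu> (min a 1) (min b 1) = copula_of \<nu> (min a 1) (min b 1)" for a b
    using eq[of "min a 1" "min b 1"] copula_of_nonpos[OF \<mu>, of "min a 1" "min b 1"]
      copula_of_nonpos[OF \<nu>, of "min a 1" "min b 1"] by force
  have bx: "{..p :: real \<times> real} = {..fst p} \<times> {..snd p}" for p
    by (auto simp: less_eq_prod_def)
  have S: "sets borel = sigma_sets UNIV (range (\<lambda>p :: real \<times> real. {..p}))"
    by (subst borel_eq_atMost) simp
  show ?thesis
  proof (rule measure_eqI_generator_eq[where \<Omega>=UNIV and E="range (\<lambda>p. {..p})" and A="\<lambda>i. {..(real i, real i)}"])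
    show "Int_stable (range (\<lambda>p :: real \<times> real. {..p}))"
    proof (rule Int_stableI)
      fix a b assume "a \<in> range (\<lambda>p :: real \<times> real. {..p})" "b \<in> range (\<lambda>p :: real \<times> real. {..p})"
      then obtain p q :: "real \<times> real" where "a = {..p}" "b = {..q}" by auto
      then have "a \<inter> b = {..inf p q}" by auto
      then show "a \<inter> b \<in> range (\<lambda>p :: real \<times> real. {..p})" by blast
    qed
    show "emeasure \<mu> X = emeasure \<nu> X" if "X \<in> range (\<lambda>p. {..p})" for X
      using that eq' by (auto simp: bx \<mu>.emeasure_eq_measure \<nu>.emeasure_eq_measure \<mu>.measure_quadrant \<nu>.measure_quadrant)
    show "sets \<mu> = sigma_sets UNIV (range (\<lambda>p. {..p}))" "sets \<nu> = sigma_sets UNIV (range (\<lambda>p. {..p}))"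
      using \<mu> \<nu> unfolding S[symmetric] by (auto simp: doubly_stochastic_def)
    show "(\<Union>i. {..(real i, real i)}) = (UNIV :: (real \<times> real) set)"
    proof (intro equalityI subset_UNIV subsetI)
      fix p :: "real \<times> real"
      obtain i :: nat where "max (fst p) (snd p) \<le> real i" using real_arch_simple by blast
      then show "p \<in> (\<Union>i. {..(real i, real i)})" by (auto simp: less_eq_prod_def)
    qed
  qed (auto simp: \<mu>.emeasure_eq_measure)
qed

lemma mu_of_eqI:
  assumes "doubly_stochastic \<mu>" "\<And>u v. u \<in> {0..1} \<Longrightarrow> v \<in> {0..1} \<Longrightarrow> B u v = copula_of \<mu> u v"
  shows "mu_of B = \<mu>"
  unfolding mu_of_def
proof (rule the_equality)
  fix \<nu> assume "doubly_stochastic \<nu> \<and> (\<forall>u\<in>{0..1}. \<forall>v\<in>{0..1}. B u v = copula_of \<nu> u v)"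
  then show "\<nu> = \<mu>"
    using assms by (intro doubly_stochastic_unique) auto
qed (use assms in auto)

section \<open>Ranks and the empirical copula\<close>

text \<open>A point counts itself, so ranks start at 1, in step with numbering grid cells by their
  right ends.\<close>

definition sample_rank :: "(nat \<Rightarrow> real) \<Rightarrow> nat \<Rightarrow> nat \<Rightarrow> nat" where
  "sample_rank f n k = card {l\<in>{..<n}. f l \<le> f k}"

text \<open>A larger value has a strictly larger counting set, so without ties ranks are distinct; n
  distinct numbers in {1..n} exhaust it.\<close>

lemma rank_bij:
  assumes "inj_on f {..<n}"
  shows "bij_betw (sample_rank f n) {..<n} {1..n}"
proof -
  have less: "sample_rank f n k < sample_rank f n k'" if "k < n" "k' < n" "f k < f k'" for k k'
  proof -
    have "{l\<in>{..<n}. f l \<le> f k} \<subseteq> {l\<in>{..<n}. f l \<le> f k'}" "k' \<in> {l\<in>{..<n}. f l \<le> f k'}"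
      "k' \<notin> {l\<in>{..<n}. f l \<le> f k}" using that by auto
    then have "{l\<in>{..<n}. f l \<le> f k} \<subset> {l\<in>{..<n}. f l \<le> f k'}" by blast
    then show ?thesis unfolding sample_rank_def by (intro psubset_card_mono) auto
  qed
  have inj: "inj_on (sample_rank f n) {..<n}"
  proof (rule inj_onI)
    fix k k' assume k: "k \<in> {..<n}" "k' \<in> {..<n}" "sample_rank f n k = sample_rank f n k'"
    then have "f k = f k'"
      using less[of k k'] less[of k' k] by (cases "f k" "f k'" rule: linorder_cases) auto
    then show "k = k'" using assms k by (auto dest: inj_onD)
  qed
  have "sample_rank f n k \<in> {1..n}" if "k < n" for k
  proof -
    have "sample_rank f n k \<noteq> 0" unfolding sample_rank_def using that by auto
    moreover have "sample_rank f n k \<le> card {..<n}" unfolding sample_rank_def by (intro card_mono) auto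
    ultimately show ?thesis by simp
  qed
  then have "sample_rank f n ` {..<n} \<subseteq> {1..n}" by auto
  then have "sample_rank f n ` {..<n} = {1..n}"
    by (intro card_subset_eq) (auto simp: card_image[OF inj])
  with inj show ?thesis by (simp add: bij_betw_def)
qed

lemma card_rank_le:
  assumes "bij_betw r {..<n} {1..n}" "p \<le> n"
  shows "card {k\<in>{..<n}. r k \<le> p} = p"
proof -
  have "card {k\<in>{..<n}. r k \<le> p} = card (r ` {k\<in>{..<n}. r k \<le> p})"
    by (intro card_image[symmetric] inj_on_subset[OF bij_betw_imp_inj_on[OF assms(1)]]) auto
  also have "r ` {k\<in>{..<n}. r k \<le> p} = {1..p}"
  proof
    show "r ` {k\<in>{..<n}. r k \<le> p} \<subseteq> {1..p}"
      using assms(1) by (auto simp: bij_betw_def)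
    show "{1..p} \<subseteq> r ` {k\<in>{..<n}. r k \<le> p}"
    proof
      fix j assume "j \<in> {1..p}"
      then have "j \<in> r ` {..<n}" using assms by (auto simp: bij_betw_def)
      then show "j \<in> r ` {k\<in>{..<n}. r k \<le> p}" using \<open>j \<in> {1..p}\<close> by auto
    qed
  qed
  finally show ?thesis by simp
qed

text \<open>Sets of sample points below a level are nested, so comparing their cardinalities decides
  inclusion. This turns any threshold on values into a threshold on ranks.\<close>

lemma le_iff_rank_le:
  fixes f :: "nat \<Rightarrow> real"
  assumes "k < n"
  shows "f k \<le> x \<longleftrightarrow> sample_rank f n k \<le> card {l\<in>{..<n}. f l \<le> x}"
proof
  assume "f k \<le> x"
  then show "sample_rank f n k \<le> card {l\<in>{..<n}. f l \<le> x}"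
    unfolding sample_rank_def by (intro card_mono) auto
next
  assume le: "sample_rank f n k \<le> card {l\<in>{..<n}. f l \<le> x}"
  show "f k \<le> x"
  proof (rule ccontr)
    assume "\<not> f k \<le> x"
    then have "{l\<in>{..<n}. f l \<le> x} \<subseteq> {l\<in>{..<n}. f l \<le> f k}" "k \<in> {l\<in>{..<n}. f l \<le> f k}"
      "k \<notin> {l\<in>{..<n}. f l \<le> x}" using assms by auto
    then have "{l\<in>{..<n}. f l \<le> x} \<subset> {l\<in>{..<n}. f l \<le> f k}" by blast
    then have "card {l\<in>{..<n}. f l \<le> x} < sample_rank f n k"
      unfolding sample_rank_def by (intro psubset_card_mono) auto
    with le show False by simp
  qed
qed

text \<open>Supplies the witness for the choice operator in \<open>emp_subcopula\<close>: the sample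
  point of rank p, or a level below the minimum for p = 0.\<close>

lemma ex_card_le_eq:
  fixes f :: "nat \<Rightarrow> real"
  assumes "inj_on f {..<n}" "p \<le> n"
  shows "\<exists>x. card {l\<in>{..<n}. f l \<le> x} = p"
proof (cases "p = 0")
  case True
  have "Min (f ` {..<n}) \<le> f l" if "l < n" for l using that by simp
  then have "\<not> f l \<le> Min (f ` {..<n}) - 1" if "l < n" for l
    using that by (smt (verit))
  then have "{l\<in>{..<n}. f l \<le> Min (f ` {..<n}) - 1} = {}" by auto
  then show ?thesis using True by (metis card.empty)
next
  case False
  then have "p \<in> sample_rank f n ` {..<n}"
    using rank_bij[OF assms(1)] assms(2) by (auto simp: bij_betw_def)
  then show ?thesis by (auto simp: sample_rank_def)
qed

text \<open>Whatever level the choice operator selects, exactly p points lie below it, so by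
  \<open>le_iff_rank_le\<close> these are the points of rank at most p and the choice does not
  matter.\<close>

lemma emp_subcopula_eq:
  assumes inj: "inj_on (\<lambda>k. X k \<omega>) {..<n}" "inj_on (\<lambda>k. Y k \<omega>) {..<n}" and "p \<le> n" "q \<le> n" "n \<ge> 1"
  shows "emp_subcopula X Y n \<omega> p q =
    real (card {k\<in>{..<n}. sample_rank (\<lambda>k. X k \<omega>) n k \<le> p \<and> sample_rank (\<lambda>k. Y k \<omega>) n k \<le> q}) / real n"
proof -
  have *: "card {l\<in>{..<n}. Z l \<omega> \<le> (SOME x. emp_F Z n \<omega> x = real p / real n)} = p"
    if "inj_on (\<lambda>k. Z k \<omega>) {..<n}" "p \<le> n" for Z :: "nat \<Rightarrow> 'a \<Rightarrow> real" and p
  proof -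
    have "\<exists>x. emp_F Z n \<omega> x = real p / real n"
      using ex_card_le_eq[OF that] unfolding emp_F_def by auto
    from someI_ex[OF this] show ?thesis
      using \<open>n \<ge> 1\<close> unfolding emp_F_def by auto
  qed
  have "k < n \<Longrightarrow> X k \<omega> \<le> (SOME x. emp_F X n \<omega> x = real p / real n) \<longleftrightarrow> sample_rank (\<lambda>k. X k \<omega>) n k \<le> p"
    "k < n \<Longrightarrow> Y k \<omega> \<le> (SOME x. emp_F Y n \<omega> x = real q / real n) \<longleftrightarrow> sample_rank (\<lambda>k. Y k \<omega>) n k \<le> q" for k
    using le_iff_rank_le[of k n "\<lambda>k. X k \<omega>"] le_iff_rank_le[of k n "\<lambda>k. Y k \<omega>"]
      *[of X p, OF inj(1) \<open>p \<le> n\<close>] *[of Y q, OF inj(2) \<open>q \<le> n\<close>] by auto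
  then show ?thesis
    unfolding emp_subcopula_def emp_H_def by (auto intro!: arg_cong[where f=card])
qed

text \<open>Half-open for every index, whereas the first interval of \<open>cb_I\<close> also
  contains 0.\<close>

abbreviation cell :: "nat \<Rightarrow> nat \<Rightarrow> real set" where
  "cell n j \<equiv> {(real j - 1) / real n<..real j / real n}"

text \<open>The cap \<open>n - 1\<close> matters at u = 1, where the floor is n although the point
  belongs to the last cell.\<close>

lemma grid_position:
  fixes u :: real
  assumes "n \<ge> 1" "0 \<le> u" "u \<le> 1"
  defines "p \<equiv> min (nat \<lfloor>real n * u\<rfloor>) (n - 1)"
  shows "p < n" "real p \<le> real n * u" "real n * u \<le> real p + 1"
proof -
  show "p < n" using assms by (auto simp: p_def)
  have f: "0 \<le> \<lfloor>real n * u\<rfloor>" using assms by simp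
  have "real p \<le> real (nat \<lfloor>real n * u\<rfloor>)" by (simp add: p_def)
  also have "\<dots> \<le> real n * u" using f by simp
  finally show "real p \<le> real n * u" .
  show "real n * u \<le> real p + 1"
  proof (cases "nat \<lfloor>real n * u\<rfloor> \<le> n - 1")
    case True
    then have "real p = of_int \<lfloor>real n * u\<rfloor>" using f by (simp add: p_def)
    then show ?thesis by linarith
  next
    case False
    then have "real p + 1 = real n" using assms by (simp add: p_def)
    then show ?thesis using assms mult_left_le[of u "real n"] by simp
  qed
qed

text \<open>The fraction of cell j below u is 1 up to index p, \<open>a\<close> for the cell that
  contains u, and 0 beyond. This is the linear interpolation between the step functions at p and p +
  1.\<close>

lemma cell_interpolation:
  fixes u :: real
  assumes "n \<ge> 1" "j \<ge> 1" "0 \<le> u" "real p \<le> real n * u" "real n * u \<le> real p + 1"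
  defines "a \<equiv> real n * u - real p"
  shows "real n * measure lborel ({0..u} \<inter> cell n j) = (1 - a) * of_bool (j \<le> p) + a * of_bool (j \<le> Suc p)"
proof -
  have n: "real n > 0" using assms by simp
  have j0: "0 \<le> (real j - 1) / real n" using assms by simp
  consider "j \<le> p" | "j = Suc p" | "j > Suc p" by linarith
  then show ?thesis
  proof cases
    case 1
    then have "real j \<le> real n * u" using assms by linarith
    then have "real j / real n \<le> u" using n by (simp add: field_simps)
    then have "{0..u} \<inter> cell n j = cell n j" using j0 by auto
    moreover have "measure lborel (cell n j) = 1 / real n" using n by (simp add: field_simps)
    ultimately show ?thesis using 1 n by simp
  next
    case 2
    have u: "(real j - 1) / real n \<le> u" "u \<le> real j / real n" using 2 assms n by (auto simp: field_simps)
    then have "{0..u} \<inter> cell n j = {(real j - 1) / real n<..u}" using j0 by auto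
    then show ?thesis using 2 n u by (simp add: field_simps a_def)
  next
    case 3
    then have "real n * u \<le> real j - 1" using assms by linarith
    then have "u \<le> (real j - 1) / real n" using n by (simp add: field_simps)
    then have "{0..u} \<inter> cell n j = {}" by auto
    then show ?thesis using 3 by simp
  qed
qed

text \<open>The empirical copula is the mixture of the uniform distributions on the grid cells given by the
  pairs of ranks; bilinear interpolation on a cell is the product of two one-dimensional linear ones.\<close>

definition rank_measure :: "nat \<Rightarrow> (nat \<Rightarrow> nat) \<Rightarrow> (nat \<Rightarrow> nat) \<Rightarrow> (real \<times> real) measure" where
  "rank_measure n r s = density (lborel \<Otimes>\<^sub>M lborel)
     (\<lambda>p. \<Sum>k<n. ennreal (real n) * indicator (cell n (r k) \<times> cell n (s k)) p)"

text \<open>Density n on a cell of area 1/n^2 gives every sample point mass 1/n. On rectangles the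
  indicator of a cell factors, which leaves one-dimensional lengths.\<close>

lemma emeasure_rank_measure:
  assumes [measurable]: "S \<in> sets borel" "T \<in> sets borel"
  shows "emeasure (rank_measure n r s) (S \<times> T) =
    ennreal (real n * (\<Sum>k<n. measure lborel (S \<inter> cell n (r k)) * measure lborel (T \<inter> cell n (s k))))"
proof -
  have fin: "emeasure lborel (S \<inter> cell n j) = ennreal (measure lborel (S \<inter> cell n j))"
    if "S \<in> sets borel" for j and S :: "real set"
  proof (rule emeasure_eq_ennreal_measure)
    have "emeasure lborel (S \<inter> cell n j) \<le> emeasure lborel (cell n j)"
      using that by (intro emeasure_mono) auto
    also have "\<dots> < top" by (subst emeasure_lborel_Ioc) (auto intro!: divide_right_mono simp: less_top)
    finally show "emeasure lborel (S \<inter> cell n j) \<noteq> top" by simp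
  qed
  have "emeasure (rank_measure n r s) (S \<times> T) =
    (\<integral>\<^sup>+p. (\<Sum>k<n. ennreal (real n) * indicator (cell n (r k) \<times> cell n (s k)) p) * indicator (S \<times> T) p \<partial>(lborel \<Otimes>\<^sub>M lborel))"
    unfolding rank_measure_def by (rule emeasure_density) measurable
  also have "\<dots> = (\<integral>\<^sup>+p. (\<Sum>k<n. ennreal (real n) * indicator ((S \<inter> cell n (r k)) \<times> (T \<inter> cell n (s k))) p) \<partial>(lborel \<Otimes>\<^sub>M lborel))"
    by (intro nn_integral_cong) (auto simp: sum_distrib_right intro!: sum.cong split: split_indicator)
  also have "\<dots> = (\<Sum>k<n. \<integral>\<^sup>+p. ennreal (real n) * indicator ((S \<inter> cell n (r k)) \<times> (T \<inter> cell n (s k))) p \<partial>(lborel \<Otimes>\<^sub>M lborel))"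
    by (rule nn_integral_sum) measurable
  also have "\<dots> = (\<Sum>k<n. ennreal (real n) * (emeasure lborel (S \<inter> cell n (r k)) * emeasure lborel (T \<inter> cell n (s k))))"
    by (intro sum.cong refl) (simp add: nn_integral_cmult lborel.emeasure_pair_measure_Times)
  also have "\<dots> = (\<Sum>k<n. ennreal (real n * (measure lborel (S \<inter> cell n (r k)) * measure lborel (T \<inter> cell n (s k)))))"
    by (simp add: fin ennreal_mult' del: ennreal_of_nat_eq_real_of_nat)
  also have "\<dots> = ennreal (real n * (\<Sum>k<n. measure lborel (S \<inter> cell n (r k)) * measure lborel (T \<inter> cell n (s k))))"
    by (subst sum_ennreal) (auto simp: sum_distrib_left)
  finally show ?thesis .
qed

lemma measure_rank_measure:
  assumes "S \<in> sets borel" "T \<in> sets borel"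
  shows "measure (rank_measure n r s) (S \<times> T) =
    real n * (\<Sum>k<n. measure lborel (S \<inter> cell n (r k)) * measure lborel (T \<inter> cell n (s k)))"
  unfolding measure_def[of "rank_measure n r s"] emeasure_rank_measure[OF assms]
  by (intro enn2real_ennreal mult_nonneg_nonneg sum_nonneg) auto

context
  fixes n :: nat and r s :: "nat \<Rightarrow> nat"
  assumes n: "n \<ge> 1" and r: "bij_betw r {..<n} {1..n}" and s: "bij_betw s {..<n} {1..n}"
begin

lemma rank_ge_1: "k < n \<Longrightarrow> r k \<ge> 1" "k < n \<Longrightarrow> s k \<ge> 1"
  using r s by (auto simp: bij_betw_def)

text \<open>The ranks visit each cell once, so the pieces of [0, u] add up to u; in terms of the
  interpolation weights, (1 - a) p + a (p + 1) = n u.\<close>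

lemma sum_cell_measure:
  assumes "bij_betw t {..<n} {1..n}" "0 \<le> u" "u \<le> 1"
  shows "(\<Sum>k<n. measure lborel ({0..u} \<inter> cell n (t k))) = u"
proof -
  define p where "p = min (nat \<lfloor>real n * u\<rfloor>) (n - 1)"
  note p = grid_position[OF n assms(2,3), folded p_def]
  define a where "a = real n * u - real p"
  have t: "k < n \<Longrightarrow> t k \<ge> 1" for k using assms(1) by (auto simp: bij_betw_def)
  have card: "card ({..<n} \<inter> {k. t k \<le> q}) = q" if "q \<le> n" for q
    using card_rank_le[OF assms(1) that] by (simp add: Int_def)
  have "real n * (\<Sum>k<n. measure lborel ({0..u} \<inter> cell n (t k))) =
      (\<Sum>k<n. (1 - a) * of_bool (t k \<le> p) + a * of_bool (t k \<le> Suc p))"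
    unfolding sum_distrib_left a_def
    using n t p assms by (intro sum.cong refl cell_interpolation) auto
  also have "\<dots> = (1 - a) * real p + a * real (Suc p)"
    using p(1) by (simp add: sum.distrib card flip: sum_distrib_left del: of_nat_Suc)
  also have "\<dots> = real n * u" by (simp add: a_def algebra_simps)
  finally show ?thesis using n by simp
qed

text \<open>Because the ranks are bijections, every row and every column of the grid contains
  exactly one charged cell, which makes both marginals uniform.\<close>

lemma rank_measure_copula: "doubly_stochastic (rank_measure n r s)"
proof -
  have full: "measure lborel ({0..1} \<inter> cell n j) = 1 / real n" "measure lborel (cell n j) = 1 / real n"
    if "j \<in> {1..n}" for j
  proof -
    have "0 \<le> (real j - 1) / real n" "real j / real n \<le> 1"
      using that n by auto
    then have "cell n j \<subseteq> {0..1}" by auto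
    then have "{0..1} \<inter> cell n j = cell n j" by auto
    moreover show "measure lborel (cell n j) = 1 / real n" using n by (simp add: field_simps)
    ultimately show "measure lborel ({0..1} \<inter> cell n j) = 1 / real n" by simp
  qed
  have rs: "r k \<in> {1..n}" "s k \<in> {1..n}" if "k \<in> {..<n}" for k
    using that r s by (auto simp: bij_betw_def)
  have sets: "sets (rank_measure n r s) = sets borel"
    by (simp add: rank_measure_def borel_prod[symmetric])
  \<comment> \<open>Total mass one is required twice, on the plane for a probability measure and on
    the unit square for its support.\<close>
  have mass: "emeasure (rank_measure n r s) (S \<times> T) = 1"
    if "S \<in> {{0..1}, UNIV}" "T \<in> {{0..1}, UNIV}" for S T
  proof -
    have "emeasure (rank_measure n r s) (S \<times> T) =
        ennreal (real n * (\<Sum>k<n. measure lborel (S \<inter> cell n (r k)) * measure lborel (T \<inter> cell n (s k))))"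
      using that by (intro emeasure_rank_measure) auto
    also have "(\<Sum>k<n. measure lborel (S \<inter> cell n (r k)) * measure lborel (T \<inter> cell n (s k))) =
        (\<Sum>k<n. 1 / real n * (1 / real n))"
      using that full[OF rs(1)] full[OF rs(2)] by (intro sum.cong refl) (elim insertE; simp)
    finally show ?thesis using n by simp
  qed
  have "emeasure (rank_measure n r s) (UNIV \<times> UNIV) = 1" by (rule mass) auto
  then have ps: "prob_space (rank_measure n r s)"
    using sets_eq_imp_space_eq[OF sets] by (intro prob_spaceI) simp
  have "emeasure (rank_measure n r s) ({0..1} \<times> {0..1}) = 1" by (rule mass) auto
  moreover have "measure (rank_measure n r s) ({0..a} \<times> UNIV) = a"
    "measure (rank_measure n r s) (UNIV \<times> {0..a}) = a" if "a \<in> {0..1}" for a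
  proof -
    have "measure (rank_measure n r s) ({0..a} \<times> UNIV) =
        real n * (\<Sum>k<n. measure lborel ({0..a} \<inter> cell n (r k)) * (1 / real n))"
      using full(2)[OF rs(2)] by (subst measure_rank_measure) (auto intro!: sum.cong)
    also have "\<dots> = a"
      using n that sum_cell_measure[OF r, of a] unfolding sum_distrib_right[symmetric] by simp
    finally show "measure (rank_measure n r s) ({0..a} \<times> UNIV) = a" .
    have "measure (rank_measure n r s) (UNIV \<times> {0..a}) =
        real n * (\<Sum>k<n. 1 / real n * measure lborel ({0..a} \<inter> cell n (s k)))"
      using full(2)[OF rs(1)] by (subst measure_rank_measure) (auto intro!: sum.cong)
    also have "\<dots> = a"
      using n that sum_cell_measure[OF s, of a] unfolding sum_distrib_left[symmetric] by simp
    finally show "measure (rank_measure n r s) (UNIV \<times> {0..a}) = a" .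
  qed
  ultimately show ?thesis
    using ps sets unfolding doubly_stochastic_def by simp
qed

text \<open>\<open>E\<close> is constrained only at grid points, so that it can be
  \<open>emp_subcopula\<close> as well as an explicit count of ranks.\<close>

lemma copula_of_rank_measure:
  assumes u: "u \<in> {0..1}" and v: "v \<in> {0..1}"
    and E: "\<And>p q. p \<le> n \<Longrightarrow> q \<le> n \<Longrightarrow> E p q = real (card {k\<in>{..<n}. r k \<le> p \<and> s k \<le> q}) / real n"
  defines "p \<equiv> min (nat \<lfloor>real n * u\<rfloor>) (n - 1)" and "q \<equiv> min (nat \<lfloor>real n * v\<rfloor>) (n - 1)"
  defines "a \<equiv> real n * u - real p" and "b \<equiv> real n * v - real q"
  shows "copula_of (rank_measure n r s) u v =
    (1 - a) * (1 - b) * E p q + a * (1 - b) * E (Suc p) q + (1 - a) * b * E p (Suc q) + a * b * E (Suc p) (Suc q)"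
proof -
  have u': "0 \<le> u" "u \<le> 1" and v': "0 \<le> v" "v \<le> 1" using u v by auto
  note p = grid_position[OF n u', folded p_def] and q = grid_position[OF n v', folded q_def]
  have E': "(\<Sum>k<n. of_bool (r k \<le> i) * of_bool (s k \<le> j)) = real n * E i j" if "i \<le> n" "j \<le> n" for i j
    using n that by (simp add: E of_bool_conj[symmetric] sum_of_bool_eq Int_def conj_commute conj_left_commute)
  have m: "real n * measure lborel ({0..u} \<inter> cell n (r k)) = (1 - a) * of_bool (r k \<le> p) + a * of_bool (r k \<le> Suc p)"
    "real n * measure lborel ({0..v} \<inter> cell n (s k)) = (1 - b) * of_bool (s k \<le> q) + b * of_bool (s k \<le> Suc q)"
    if "k < n" for k
    using cell_interpolation[OF n rank_ge_1(1)[OF that] u'(1) p(2,3)]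
      cell_interpolation[OF n rank_ge_1(2)[OF that] v'(1) q(2,3)] by (simp_all add: a_def b_def)
  have "real n * copula_of (rank_measure n r s) u v =
      (\<Sum>k<n. (real n * measure lborel ({0..u} \<inter> cell n (r k))) * (real n * measure lborel ({0..v} \<inter> cell n (s k))))"
    unfolding copula_of_def by (subst measure_rank_measure) (auto simp: sum_distrib_left algebra_simps)
  also have "\<dots> = (\<Sum>k<n. ((1 - a) * of_bool (r k \<le> p) + a * of_bool (r k \<le> Suc p)) *
      ((1 - b) * of_bool (s k \<le> q) + b * of_bool (s k \<le> Suc q)))"
    by (intro sum.cong refl) (simp only: m lessThan_iff)
  also have "\<dots> = (\<Sum>k<n. (1 - a) * (1 - b) * (of_bool (r k \<le> p) * of_bool (s k \<le> q))
      + a * (1 - b) * (of_bool (r k \<le> Suc p) * of_bool (s k \<le> q))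
      + (1 - a) * b * (of_bool (r k \<le> p) * of_bool (s k \<le> Suc q))
      + a * b * (of_bool (r k \<le> Suc p) * of_bool (s k \<le> Suc q)))"
    by (intro sum.cong refl) (simp only: algebra_simps)
  also have "\<dots> = real n * ((1 - a) * (1 - b) * E p q + a * (1 - b) * E (Suc p) q + (1 - a) * b * E p (Suc q) + a * b * E (Suc p) (Suc q))"
    using p(1) q(1)
    by (simp only: sum.distrib sum_distrib_left[symmetric] E' Suc_le_eq less_imp_le) (simp only: algebra_simps)
  finally show ?thesis using n by simp
qed

end

text \<open>A nondecreasing map can only damage the order by creating ties, and injectivity on the
  transformed sample excludes those.\<close>

lemma rank_comp_mono:
  fixes F :: "real \<Rightarrow> real" and f :: "nat \<Rightarrow> real"
  assumes "mono F" "inj_on (\<lambda>k. F (f k)) {..<n}" "k < n"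
  shows "sample_rank (\<lambda>k. F (f k)) n k = sample_rank f n k"
proof -
  have "F (f l) \<le> F (f k) \<longleftrightarrow> f l \<le> f k" if "l < n" for l
  proof (cases "f l \<le> f k")
    case True
    then show ?thesis using monoD[OF \<open>mono F\<close>, of "f l" "f k"] by simp
  next
    case False
    then have "F (f k) \<le> F (f l)" using monoD[OF \<open>mono F\<close>, of "f k" "f l"] by simp
    moreover have "F (f k) \<noteq> F (f l)"
      using inj_onD[OF assms(2), of k l] that assms(3) False by auto
    ultimately show ?thesis using False by simp
  qed
  then have "{l\<in>{..<n}. F (f l) \<le> F (f k)} = {l\<in>{..<n}. f l \<le> f k}" by auto
  then show ?thesis unfolding sample_rank_def by simp
qed

text \<open>The transformation by the (merely nondecreasing) distribution function can merge at most
  one sample point into the level of \<open>x\<close>.\<close>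

lemma card_le_comp_mono:
  fixes F :: "real \<Rightarrow> real" and f :: "nat \<Rightarrow> real"
  assumes "mono F" "inj_on (\<lambda>k. F (f k)) {..<n}"
  shows "card {k\<in>{..<n}. f k \<le> x} \<le> card {k\<in>{..<n}. F (f k) \<le> F x}"
    and "card {k\<in>{..<n}. F (f k) \<le> F x} \<le> Suc (card {k\<in>{..<n}. f k \<le> x})"
proof -
  show "card {k\<in>{..<n}. f k \<le> x} \<le> card {k\<in>{..<n}. F (f k) \<le> F x}"
  proof (rule card_mono)
    show "finite {k\<in>{..<n}. F (f k) \<le> F x}" by simp
    show "{k\<in>{..<n}. f k \<le> x} \<subseteq> {k\<in>{..<n}. F (f k) \<le> F x}"
      using monoD[OF assms(1)] by blast
  qed
  let ?T = "{k\<in>{..<n}. F (f k) = F x}"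
  have sub: "{k\<in>{..<n}. F (f k) \<le> F x} \<subseteq> {k\<in>{..<n}. f k \<le> x} \<union> ?T"
  proof
    fix k assume k: "k \<in> {k\<in>{..<n}. F (f k) \<le> F x}"
    show "k \<in> {k\<in>{..<n}. f k \<le> x} \<union> ?T"
    proof (cases "f k \<le> x")
      case False
      then have "F x \<le> F (f k)" using monoD[OF assms(1), of x "f k"] by simp
      with k show ?thesis by auto
    qed (use k in auto)
  qed
  have "card ?T \<le> Suc 0"
    using inj_onD[OF assms(2)] by (subst card_le_Suc0_iff_eq) auto
  then have "card ({k\<in>{..<n}. f k \<le> x} \<union> ?T) \<le> Suc (card {k\<in>{..<n}. f k \<le> x})"
    using card_Un_le[of "{k\<in>{..<n}. f k \<le> x}" ?T] by linarith
  then show "card {k\<in>{..<n}. F (f k) \<le> F x} \<le> Suc (card {k\<in>{..<n}. f k \<le> x})"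
    using card_mono[OF _ sub] by force
qed

text \<open>Exactly b - a points have rank in {a<..b}, so the condition \<open>P\<close> can select
  at most that many of them.\<close>

lemma card_rank_le_Lipschitz:
  assumes r: "bij_betw r {..<n} {1..n}" and "p \<le> n" "p' \<le> n"
  shows "\<bar>real (card {k\<in>{..<n}. r k \<le> p \<and> P k}) - real (card {k\<in>{..<n}. r k \<le> p' \<and> P k})\<bar> \<le> \<bar>real p - real p'\<bar>"
proof -
  have *: "card {k\<in>{..<n}. r k \<le> a \<and> P k} \<le> card {k\<in>{..<n}. r k \<le> b \<and> P k}"
    "card {k\<in>{..<n}. r k \<le> b \<and> P k} + a \<le> card {k\<in>{..<n}. r k \<le> a \<and> P k} + b" if "a \<le> b" "b \<le> n" for a b
  proof -
    show "card {k\<in>{..<n}. r k \<le> a \<and> P k} \<le> card {k\<in>{..<n}. r k \<le> b \<and> P k}"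
      using that by (intro card_mono) auto
    let ?D = "{k\<in>{..<n}. r k \<le> b} - {k\<in>{..<n}. r k \<le> a}"
    have "card ?D = card {k\<in>{..<n}. r k \<le> b} - card {k\<in>{..<n}. r k \<le> a}"
      using that by (intro card_Diff_subset) auto
    then have "card ?D = b - a"
      using card_rank_le[OF r, of a] card_rank_le[OF r, of b] that by simp
    moreover have "card {k\<in>{..<n}. r k \<le> b \<and> P k} \<le> card ({k\<in>{..<n}. r k \<le> a \<and> P k} \<union> ?D)"
      using that by (intro card_mono) auto
    moreover have "\<dots> \<le> card {k\<in>{..<n}. r k \<le> a \<and> P k} + card ?D"
      by (rule card_Un_le)
    ultimately show "card {k\<in>{..<n}. r k \<le> b \<and> P k} + a \<le> card {k\<in>{..<n}. r k \<le> a \<and> P k} + b"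
      using that by linarith
  qed
  show ?thesis
    using *[of p p'] *[of p' p] assms by (cases "p \<le> p'") auto
qed

lemma convex_comb4_close:
  fixes a b :: real
  assumes "0 \<le> a" "a \<le> 1" "0 \<le> b" "b \<le> 1"
    and "\<bar>e1 - c\<bar> \<le> d" "\<bar>e2 - c\<bar> \<le> d" "\<bar>e3 - c\<bar> \<le> d" "\<bar>e4 - c\<bar> \<le> d"
  shows "\<bar>(1 - a) * (1 - b) * e1 + a * (1 - b) * e2 + (1 - a) * b * e3 + a * b * e4 - c\<bar> \<le> d"
proof -
  define w1 w2 w3 w4 where w: "w1 = (1 - a) * (1 - b)" "w2 = a * (1 - b)" "w3 = (1 - a) * b" "w4 = a * b"
  have w0: "0 \<le> w1" "0 \<le> w2" "0 \<le> w3" "0 \<le> w4" using assms by (auto simp: w)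
  have w1: "w1 + w2 + w3 + w4 = 1" by (simp add: w algebra_simps)
  have "\<bar>w1 * e1 + w2 * e2 + w3 * e3 + w4 * e4 - c\<bar> =
      \<bar>w1 * (e1 - c) + w2 * (e2 - c) + w3 * (e3 - c) + w4 * (e4 - c)\<bar>"
  proof -
    have "w1 * (e1 - c) + w2 * (e2 - c) + w3 * (e3 - c) + w4 * (e4 - c) =
        w1 * e1 + w2 * e2 + w3 * e3 + w4 * e4 - (w1 + w2 + w3 + w4) * c" by (simp add: algebra_simps)
    then show ?thesis using w1 by simp
  qed
  also have "\<dots> \<le> \<bar>w1 * (e1 - c)\<bar> + \<bar>w2 * (e2 - c)\<bar> + \<bar>w3 * (e3 - c)\<bar> + \<bar>w4 * (e4 - c)\<bar>" by linarith
  also have "\<dots> \<le> w1 * d + w2 * d + w3 * d + w4 * d"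
    using assms w0 by (intro add_mono) (auto simp: abs_mult intro!: mult_left_mono)
  also have "\<dots> = (w1 + w2 + w3 + w4) * d" by (simp add: algebra_simps)
  finally show ?thesis using w1 by (simp add: w)
qed

text \<open>A deterministic setting: one realisation of the transformed sample, with all probability
  hidden in \<open>err\<close>. By the bounds with 1, \<open>err\<close> at p = n or q = n also
  controls the marginals.\<close>

locale uniform_sample = copula_measure \<mu> for \<mu> +
  fixes U V :: "nat \<Rightarrow> real" and n :: nat and \<epsilon> :: real
  assumes n: "n \<ge> 1"
    and injU: "inj_on U {..<n}" and injV: "inj_on V {..<n}"
    and U_le_1: "\<And>k. U k \<le> 1" and V_le_1: "\<And>k. V k \<le> 1"
    and err: "\<And>p q. p \<le> n \<Longrightarrow> q \<le> n \<Longrightarrow>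
      \<bar>real (card {k\<in>{..<n}. U k \<le> real p / real n \<and> V k \<le> real q / real n}) / real n
        - copula_of \<mu> (real p / real n) (real q / real n)\<bar> \<le> \<epsilon>"
begin

lemma unit_grid: "p \<le> n \<Longrightarrow> real p / real n \<in> {0..1}"
  using n by (simp add: field_simps)

lemma marginal_grid_err:
  assumes "p \<le> n"
  shows "\<bar>real (card {k\<in>{..<n}. U k \<le> real p / real n}) / real n - real p / real n\<bar> \<le> \<epsilon>"
    and "\<bar>real (card {k\<in>{..<n}. V k \<le> real p / real n}) / real n - real p / real n\<bar> \<le> \<epsilon>"
  using err[of p n] err[of n p] assms n U_le_1 V_le_1 unit_grid[OF assms]
  by (simp_all add: copula_of_1)

text \<open>If \<open>p'\<close> sample points satisfy \<open>U k \<le> p / n\<close>, these are exactly the points of rank at most \<open>p'\<close>.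
  Passing from values to ranks therefore only moves the grid point by the error of the marginals,
  which is controlled by \<open>err\<close> on the upper boundary of the unit square.\<close>

lemma rank_grid_err:
  assumes "p \<le> n" "q \<le> n"
  shows "\<bar>real (card {k\<in>{..<n}. sample_rank U n k \<le> p \<and> sample_rank V n k \<le> q}) / real n
    - copula_of \<mu> (real p / real n) (real q / real n)\<bar> \<le> 3 * \<epsilon>"
proof -
  define p' where "p' = card {k\<in>{..<n}. U k \<le> real p / real n}"
  define q' where "q' = card {k\<in>{..<n}. V k \<le> real q / real n}"
  define c where "c i j = real (card {k\<in>{..<n}. sample_rank U n k \<le> i \<and> sample_rank V n k \<le> j})" for i j
  have le: "p' \<le> n" "q' \<le> n"
    using card_mono[of "{..<n}" "{k\<in>{..<n}. U k \<le> real p / real n}"]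
      card_mono[of "{..<n}" "{k\<in>{..<n}. V k \<le> real q / real n}"] by (auto simp: p'_def q'_def)
  have "{k\<in>{..<n}. U k \<le> real p / real n \<and> V k \<le> real q / real n} =
      {k\<in>{..<n}. sample_rank U n k \<le> p' \<and> sample_rank V n k \<le> q'}"
    unfolding p'_def q'_def using le_iff_rank_le[of _ n U] le_iff_rank_le[of _ n V] by blast
  then have 1: "\<bar>c p' q' / real n - copula_of \<mu> (real p / real n) (real q / real n)\<bar> \<le> \<epsilon>"
    using err[OF assms] by (simp add: c_def)
  have "\<bar>c p q - c p' q\<bar> \<le> \<bar>real p - real p'\<bar>"
    unfolding c_def by (rule card_rank_le_Lipschitz[OF rank_bij[OF injU] assms(1) le(1)])
  moreover have "\<bar>c p' q - c p' q'\<bar> \<le> \<bar>real q - real q'\<bar>"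
    using card_rank_le_Lipschitz[OF rank_bij[OF injV] assms(2) le(2), of "\<lambda>k. sample_rank U n k \<le> p'"]
    unfolding c_def by (simp add: conj_commute)
  ultimately have "\<bar>c p q - c p' q'\<bar> / real n \<le> (\<bar>real p - real p'\<bar> + \<bar>real q - real q'\<bar>) / real n"
    by (intro divide_right_mono) auto
  also have "\<dots> = \<bar>real p' / real n - real p / real n\<bar> + \<bar>real q' / real n - real q / real n\<bar>"
    using n by (simp add: add_divide_distrib abs_minus_commute flip: diff_divide_distrib)
  also have "\<dots> \<le> 2 * \<epsilon>"
    using marginal_grid_err(1)[OF assms(1)] marginal_grid_err(2)[OF assms(2)] by (simp add: p'_def q'_def)
  finally have "\<bar>c p q / real n - c p' q' / real n\<bar> \<le> 2 * \<epsilon>"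
    by (simp flip: diff_divide_distrib)
  with 1 show ?thesis unfolding c_def by linarith
qed

text \<open>Interpolation is a convex combination of four corner values. Each has error 3 \<epsilon>
  as a rank count, and moving from the corner to (u, v) costs at most 1/n per coordinate by the
  Lipschitz property.\<close>

lemma rank_measure_err:
  assumes u: "u \<in> {0..1}" and v: "v \<in> {0..1}"
  shows "\<bar>copula_of (rank_measure n (sample_rank U n) (sample_rank V n)) u v - copula_of \<mu> u v\<bar> \<le> 3 * \<epsilon> + 2 / real n"
proof -
  define E where "E p q = real (card {k\<in>{..<n}. sample_rank U n k \<le> p \<and> sample_rank V n k \<le> q}) / real n" for p q
  define p where "p = min (nat \<lfloor>real n * u\<rfloor>) (n - 1)"
  define q where "q = min (nat \<lfloor>real n * v\<rfloor>) (n - 1)"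
  have u': "0 \<le> u" "u \<le> 1" and v': "0 \<le> v" "v \<le> 1" using u v by auto
  note p = grid_position[OF n u', folded p_def] and q = grid_position[OF n v', folded q_def]
  have close: "\<bar>E i j - copula_of \<mu> u v\<bar> \<le> 3 * \<epsilon> + 2 / real n"
    if "i \<in> {p, Suc p}" "j \<in> {q, Suc q}" for i j
  proof -
    have ij: "i \<le> n" "j \<le> n" using that p(1) q(1) by auto
    have "\<bar>real n * u - real i\<bar> \<le> 1" "\<bar>real n * v - real j\<bar> \<le> 1" using that p q by auto
    then have "\<bar>real n * u - real i\<bar> / real n \<le> 1 / real n" "\<bar>real n * v - real j\<bar> / real n \<le> 1 / real n"
      by (auto intro!: divide_right_mono)
    moreover have "(real n * u - real i) / real n = u - real i / real n"
      "(real n * v - real j) / real n = v - real j / real n"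
      using n by (simp_all add: diff_divide_distrib)
    then have "\<bar>real n * u - real i\<bar> / real n = \<bar>u - real i / real n\<bar>"
      "\<bar>real n * v - real j\<bar> / real n = \<bar>v - real j / real n\<bar>"
      by (metis abs_divide abs_of_nat)+
    moreover have "\<bar>copula_of \<mu> u v - copula_of \<mu> (real i / real n) (real j / real n)\<bar> \<le>
        \<bar>u - real i / real n\<bar> + \<bar>v - real j / real n\<bar>"
      by (rule copula_of_Lipschitz[OF u unit_grid[OF ij(1)] v unit_grid[OF ij(2)]])
    moreover have "\<bar>E i j - copula_of \<mu> (real i / real n) (real j / real n)\<bar> \<le> 3 * \<epsilon>"
      unfolding E_def by (rule rank_grid_err[OF ij])
    ultimately show ?thesis by linarith
  qed
  show ?thesis
    unfolding copula_of_rank_measure[OF n rank_bij[OF injU] rank_bij[OF injV] u v E_def, folded p_def q_def]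
    by (rule convex_comb4_close) (use p q close in auto)
qed

text \<open>Counts are monotone in the level, so u can be squeezed between neighbouring grid points
  at the cost of 1/n.\<close>

lemma marginal_err:
  assumes u: "u \<in> {0..1}"
  shows "\<bar>real (card {k\<in>{..<n}. U k \<le> u}) / real n - u\<bar> \<le> \<epsilon> + 1 / real n"
    and "\<bar>real (card {k\<in>{..<n}. V k \<le> u}) / real n - u\<bar> \<le> \<epsilon> + 1 / real n"
proof -
  define p where "p = min (nat \<lfloor>real n * u\<rfloor>) (n - 1)"
  note p = grid_position[OF n, of u, folded p_def]
  have pn: "p \<le> n" "Suc p \<le> n" and pu: "real p / real n \<le> u" "u \<le> real (Suc p) / real n"
    and d: "real (Suc p) / real n = real p / real n + 1 / real n"
    using p u n by (auto simp: field_simps)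
  have *: "\<bar>real (card {k\<in>{..<n}. W k \<le> u}) / real n - u\<bar> \<le> \<epsilon> + 1 / real n"
    if W: "\<And>p. p \<le> n \<Longrightarrow> \<bar>real (card {k\<in>{..<n}. W k \<le> real p / real n}) / real n - real p / real n\<bar> \<le> \<epsilon>"
    for W :: "nat \<Rightarrow> real"
  proof -
    have "card {k\<in>{..<n}. W k \<le> real p / real n} \<le> card {k\<in>{..<n}. W k \<le> u}"
      "card {k\<in>{..<n}. W k \<le> u} \<le> card {k\<in>{..<n}. W k \<le> real (Suc p) / real n}"
      using pu by (auto intro!: card_mono)
    then have "real (card {k\<in>{..<n}. W k \<le> real p / real n}) / real n \<le> real (card {k\<in>{..<n}. W k \<le> u}) / real n"
      "real (card {k\<in>{..<n}. W k \<le> u}) / real n \<le> real (card {k\<in>{..<n}. W k \<le> real (Suc p) / real n}) / real n"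
      by (auto intro!: divide_right_mono)
    with W[OF pn(1)] W[OF pn(2)] pu d show ?thesis by linarith
  qed
  show "\<bar>real (card {k\<in>{..<n}. U k \<le> u}) / real n - u\<bar> \<le> \<epsilon> + 1 / real n"
    "\<bar>real (card {k\<in>{..<n}. V k \<le> u}) / real n - u\<bar> \<le> \<epsilon> + 1 / real n"
    by (rule *[OF marginal_grid_err(1)], assumption) (rule *[OF marginal_grid_err(2)], assumption)
qed

end

text \<open>Without ties the interpolation is a genuine copula, so the definite description inside
  \<open>cb_kernel\<close> is well defined and becomes an explicit measure.\<close>

lemma emp_copula_mu_of:
  assumes n: "n \<ge> 1" and inj: "inj_on (\<lambda>k. X k \<omega>) {..<n}" "inj_on (\<lambda>k. Y k \<omega>) {..<n}"
  defines "\<rho> \<equiv> rank_measure n (sample_rank (\<lambda>k. X k \<omega>) n) (sample_rank (\<lambda>k. Y k \<omega>) n)"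
  shows "doubly_stochastic \<rho>" "mu_of (emp_copula X Y n \<omega>) = \<rho>"
proof -
  show ds: "doubly_stochastic \<rho>"
    unfolding \<rho>_def by (intro rank_measure_copula n rank_bij inj)
  show "mu_of (emp_copula X Y n \<omega>) = \<rho>"
  proof (rule mu_of_eqI[OF ds])
    fix u v :: real assume "u \<in> {0..1}" "v \<in> {0..1}"
    then show "emp_copula X Y n \<omega> u v = copula_of \<rho> u v"
      unfolding \<rho>_def emp_copula_def Let_def
      by (intro copula_of_rank_measure[symmetric] n rank_bij inj emp_subcopula_eq)
  qed
qed

section \<open>Checkerboard kernels\<close>

lemma cb_I_disjoint:
  assumes "i \<in> {1..N}" "i' \<in> {1..N}" "u \<in> cb_I N i" "u \<in> cb_I N i'"
  shows "i = i'"
proof -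
  have *: False if ii: "1 \<le> i" "i < i'" "u \<in> cb_I N i" "u \<in> cb_I N i'" for i i'
  proof -
    have "u \<le> real i / real N" using ii by (auto simp: cb_I_def split: if_splits)
    also have "\<dots> \<le> (real i' - 1) / real N" using ii by (intro divide_right_mono) auto
    also have "\<dots> < u" using ii by (auto simp: cb_I_def split: if_splits)
    finally show False by simp
  qed
  show ?thesis
    using *[of i i'] *[of i' i] assms by (cases i i' rule: linorder_cases) auto
qed

lemma cb_I_cover:
  assumes "N \<ge> 1" "u \<in> {0..1}"
  obtains i where "i \<in> {1..N}" "u \<in> cb_I N i"
proof (cases "u = 0")
  case True
  then show ?thesis using assms by (intro that[of 1]) (auto simp: cb_I_def)
next
  case False
  \<comment> \<open>The ceiling fits intervals that are closed on the right; 0 is the one point it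
    would misplace.\<close>
  define i where "i = nat \<lceil>real N * u\<rceil>"
  have N: "real N > 0" using assms by simp
  have pos: "0 < real N * u" using False assms by simp
  have "real i = of_int \<lceil>real N * u\<rceil>" using pos by (simp add: i_def)
  then have i: "real i - 1 < real N * u" "real N * u \<le> real i" by linarith+
  have "1 \<le> i" using pos i by linarith
  moreover have "i \<le> N"
    using assms mult_left_le[of u "real N"] by (simp add: i_def ceiling_le_iff)
  moreover have "(real i - 1) / real N < u" "u \<le> real i / real N"
    using i N by (auto simp: field_simps)
  ultimately show ?thesis
    using assms(2) by (intro that[of i]) (auto simp: cb_I_def)
qed

text \<open>The two intervals agree up to the null set {0}.\<close>

lemma measure_cb_I:
  assumes "j \<ge> 1" "N \<ge> 1"
  shows "measure lborel ({0..v} \<inter> cb_I N j) = measure lborel ({0..v} \<inter> cell N j)"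
proof (cases "j = 1")
  case True
  have "measure lborel ({0..v} \<inter> {0..1 / real N}) = measure lborel ({0..v} \<inter> {0<..1 / real N})"
    by (rule measure_eq_AE) (use AE_lborel_singleton[of 0] in \<open>auto elim!: eventually_mono\<close>)
  with True show ?thesis by (simp add: cb_I_def)
qed (simp add: cb_I_def)

text \<open>N times this length is the fraction of column j that lies below v.\<close>

lemma cb_weight:
  assumes "j \<ge> 1" "N \<ge> 1"
  shows "0 \<le> real N * measure lborel ({0..v} \<inter> cb_I N j)" "real N * measure lborel ({0..v} \<inter> cb_I N j) \<le> 1"
    and "real j / real N \<le> v \<Longrightarrow> real N * measure lborel ({0..v} \<inter> cb_I N j) = 1"
    and "v \<le> (real j - 1) / real N \<Longrightarrow> measure lborel ({0..v} \<inter> cb_I N j) = 0"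
proof -
  have c: "measure lborel (cell N j) = 1 / real N" using assms by (simp add: field_simps)
  have "measure lborel ({0..v} \<inter> cell N j) \<le> measure lborel (cell N j)"
  proof (rule measure_mono_fmeasurable)
    show "cell N j \<in> fmeasurable lborel"
      by (rule fmeasurableI2[OF fmeasurable_compact[OF compact_Icc[of "(real j - 1) / real N" "real j / real N"]]]) auto
  qed auto
  then show "0 \<le> real N * measure lborel ({0..v} \<inter> cb_I N j)" "real N * measure lborel ({0..v} \<inter> cb_I N j) \<le> 1"
    using assms c by (auto simp: measure_cb_I field_simps)
  {
    assume "real j / real N \<le> v"
    moreover have "0 \<le> (real j - 1) / real N" using assms by simp
    ultimately have "{0..v} \<inter> cell N j = cell N j" by auto
    then show "real N * measure lborel ({0..v} \<inter> cb_I N j) = 1"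
      using c assms by (simp add: measure_cb_I)
  }
  {
    assume "v \<le> (real j - 1) / real N"
    then have "{0..v} \<inter> cell N j = {}" by auto
    then show "measure lborel ({0..v} \<inter> cb_I N j) = 0"
      using assms by (simp add: measure_cb_I)
  }
qed

lemma cb_weight_mono:
  assumes "v \<le> v'"
  shows "measure lborel ({0..v} \<inter> cb_I N j) \<le> measure lborel ({0..v'} \<inter> cb_I N j)"
proof (rule measure_mono_fmeasurable)
  show "{0..v} \<inter> cb_I N j \<subseteq> {0..v'} \<inter> cb_I N j" using assms by auto
  have "cb_I N j \<in> sets lborel" by (simp add: cb_I_def)
  then show "{0..v} \<inter> cb_I N j \<in> sets lborel" by simp
  show "{0..v'} \<inter> cb_I N j \<in> fmeasurable lborel"
    using \<open>cb_I N j \<in> sets lborel\<close> by (intro fmeasurable_Int_fmeasurable fmeasurable_compact compact_Icc)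
qed

text \<open>Exactly one row contains u. Of the factor N^2, one N normalises lengths to weights in
  [0, 1]; the other turns masses within the row into conditional probabilities.\<close>

lemma cb_kernel_eq:
  assumes "i \<in> {1..N}" "u \<in> cb_I N i"
  shows "cb_kernel N B u v = real N * (\<Sum>j\<in>{1..N}. measure (mu_of B) (cb_Q N i j) *
    (real N * measure lborel ({0..v} \<inter> cb_I N j)))"
proof -
  have ind: "indicator (cb_I N i') u = (if i' = i then 1 else 0 :: real)" if "i' \<in> {1..N}" for i'
  proof (cases "i' = i")
    case False
    then have "u \<notin> cb_I N i'" using cb_I_disjoint[OF assms(1) that assms(2)] by blast
    then show ?thesis using False by simp
  qed (use assms(2) in simp)
  have "(\<Sum>i'\<in>{1..N}. \<Sum>j\<in>{1..N}. measure (mu_of B) (cb_Q N i' j) * indicator (cb_I N i') u *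
      measure lborel ({0..v} \<inter> cb_I N j)) =
    (\<Sum>i'\<in>{1..N}. if i' = i then \<Sum>j\<in>{1..N}. measure (mu_of B) (cb_Q N i j) * measure lborel ({0..v} \<inter> cb_I N j) else 0)"
    by (intro sum.cong refl) (simp add: ind)
  also have "\<dots> = (\<Sum>j\<in>{1..N}. measure (mu_of B) (cb_Q N i j) * measure lborel ({0..v} \<inter> cb_I N j))"
    using assms(1) by (simp add: sum.delta)
  finally show ?thesis
    unfolding cb_kernel_def by (simp only: sum_distrib_left power2_eq_square mult_ac)
qed

lemma cb_kernel_mono:
  assumes "v \<le> v'"
  shows "cb_kernel N B u v \<le> cb_kernel N B u v'"
  unfolding cb_kernel_def
  by (intro mult_left_mono sum_mono cb_weight_mono[OF assms]) auto

section \<open>Bounds and limits for the checkerboard kernel of a copula measure\<close>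

context copula_measure
begin

lemma measure_cb_I_Icc:
  assumes "i \<ge> 1" "N \<ge> 1"
  shows "measure \<mu> (cb_I N i \<times> {0..w}) = copula_of \<mu> (real i / real N) w - copula_of \<mu> ((real i - 1) / real N) w"
proof (cases "i = 1")
  case True
  then show ?thesis using copula_of_nonpos[OF ds, of 0 w] by (simp add: cb_I_def copula_of_def)
next
  case False
  have "measure \<mu> ({(real i - 1) / real N<..real i / real N} \<times> {0..w}) =
      copula_of \<mu> (real i / real N) w - copula_of \<mu> ((real i - 1) / real N) w"
    by (rule measure_Ioc_Icc) (simp add: divide_right_mono)
  with False show ?thesis by (simp add: cb_I_def)
qed

lemma sum_measure_cb_Q:
  assumes "N \<ge> 1" "m \<le> N"
  shows "(\<Sum>j\<in>{1..m}. measure \<mu> (cb_Q N i j)) = measure \<mu> (cb_I N i \<times> {0..real m / real N})"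
proof (induction m)
  case 0
  have [measurable]: "cb_I N i \<in> sets borel" by (simp add: cb_I_def)
  have "measure \<mu> (cb_I N i \<times> {0..0}) \<le> measure \<mu> (UNIV \<times> {0..0})"
    by (intro finite_measure_mono) (auto simp: sets_eq)
  then show ?case using measure_strip(2)[of 0] by (simp add: measure_le_0_iff)
next
  case (Suc m)
  have [measurable]: "cb_I N i \<in> sets borel" "cb_I N (Suc m) \<in> sets borel" by (simp_all add: cb_I_def)
  \<comment> \<open>The first column contains 0 and so overlaps \<open>{0..0}\<close>; it cannot be
    split off as a disjoint piece like the later ones.\<close>
  show ?case
  proof (cases "m = 0")
    case True
    then show ?thesis by (simp add: cb_Q_def cb_I_def)
  next
    case False
    have "real m / real N \<le> real (Suc m) / real N" by (intro divide_right_mono) auto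
    then have "{0..real (Suc m) / real N} = {0..real m / real N} \<union> cb_I N (Suc m)"
      "{0..real m / real N} \<inter> cb_I N (Suc m) = {}"
      using False by (auto simp: cb_I_def) (smt (verit) divide_nonneg_nonneg of_nat_0_le_iff)
    then have "measure \<mu> (cb_I N i \<times> {0..real (Suc m) / real N}) =
        measure \<mu> (cb_I N i \<times> {0..real m / real N} \<union> cb_I N i \<times> cb_I N (Suc m))"
      and "(cb_I N i \<times> {0..real m / real N}) \<inter> (cb_I N i \<times> cb_I N (Suc m)) = {}"
      by (simp_all add: Times_Un_distrib1[symmetric] Sigma_Un_distrib2) blast
    then have "measure \<mu> (cb_I N i \<times> {0..real (Suc m) / real N}) =
        measure \<mu> (cb_I N i \<times> {0..real m / real N}) + measure \<mu> (cb_Q N i (Suc m))"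
      unfolding cb_Q_def by (simp add: finite_measure_Union sets_eq)
    then show ?thesis using Suc.IH by simp
  qed
qed

text \<open>If m/N lies below v, the first m columns have full weight and the others contribute
  nonnegatively; if it lies above v, the columns beyond m have weight 0 and the first m at most 1.
  The sum over m full columns telescopes to \<open>g\<close>.\<close>

lemma cb_kernel_bounds:
  assumes B: "mu_of B = \<mu>" and N: "N \<ge> 1" and i: "i \<in> {1..N}" "u \<in> cb_I N i" and m: "m \<le> N"
  defines "g \<equiv> copula_of \<mu> (real i / real N) (real m / real N) - copula_of \<mu> ((real i - 1) / real N) (real m / real N)"
  shows "real m / real N \<le> v \<Longrightarrow> real N * g \<le> cb_kernel N B u v"
    and "v \<le> real m / real N \<Longrightarrow> cb_kernel N B u v \<le> real N * g"
proof -
  define w where "w j = real N * measure lborel ({0..v} \<inter> cb_I N j)" for j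
  have K: "cb_kernel N B u v = real N * (\<Sum>j\<in>{1..N}. measure \<mu> (cb_Q N i j) * w j)"
    by (simp add: cb_kernel_eq[OF i] B w_def)
  have g: "g = (\<Sum>j\<in>{1..m}. measure \<mu> (cb_Q N i j))"
    using measure_cb_I_Icc[of i N "real m / real N"] sum_measure_cb_Q[OF N m, of i] i N by (simp add: g_def)
  have w: "j \<in> {1..N} \<Longrightarrow> 0 \<le> w j" "j \<in> {1..N} \<Longrightarrow> w j \<le> 1" for j
    using cb_weight(1,2)[of j N v] N by (auto simp: w_def)
  {
    assume v: "real m / real N \<le> v"
    have "g = (\<Sum>j\<in>{1..m}. measure \<mu> (cb_Q N i j) * w j)"
      unfolding g
    proof (intro sum.cong refl)
      fix j assume j: "j \<in> {1..m}"
      then have "real j / real N \<le> real m / real N" by (intro divide_right_mono) auto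
      then have "w j = 1" using cb_weight(3)[of j N v] j N v by (simp add: w_def)
      then show "measure \<mu> (cb_Q N i j) = measure \<mu> (cb_Q N i j) * w j" by simp
    qed
    also have "\<dots> \<le> (\<Sum>j\<in>{1..N}. measure \<mu> (cb_Q N i j) * w j)"
      using m w by (intro sum_mono2) auto
    finally show "real N * g \<le> cb_kernel N B u v"
      unfolding K by (intro mult_left_mono) auto
  }
  {
    assume v: "v \<le> real m / real N"
    have "(\<Sum>j\<in>{1..N}. measure \<mu> (cb_Q N i j) * w j) = (\<Sum>j\<in>{1..m}. measure \<mu> (cb_Q N i j) * w j)"
    proof (intro sum.mono_neutral_right ballI)
      fix j assume j: "j \<in> {1..N} - {1..m}"
      then have "real m / real N \<le> (real j - 1) / real N" by (intro divide_right_mono) auto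
      then show "measure \<mu> (cb_Q N i j) * w j = 0"
        using cb_weight(4)[of j N v] j N v by (simp add: w_def)
    qed (use m in auto)
    also have "\<dots> \<le> g"
      unfolding g using m w by (intro sum_mono mult_left_le) auto
    finally show "cb_kernel N B u v \<le> real N * g"
      unfolding K by (intro mult_left_mono) auto
  }
qed

text \<open>At v = m/N both bounds of \<open>cb_kernel_bounds\<close> apply and determine the
  kernel; a full row has mass 1/N.\<close>

lemma cb_kernel_0_1:
  assumes B: "mu_of B = \<mu>" and N: "N \<ge> 1" and u: "u \<in> {0..1}"
  shows "cb_kernel N B u 0 = 0" "cb_kernel N B u 1 = 1"
proof -
  obtain i where i: "i \<in> {1..N}" "u \<in> cb_I N i" using cb_I_cover[OF N u] .
  show "cb_kernel N B u 0 = 0"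
    using cb_kernel_bounds[OF B N i, of 0 0] copula_of_nonpos[OF ds] by simp
  have "real i / real N \<le> 1" "0 \<le> (real i - 1) / real N" "(real i - 1) / real N \<le> 1"
    using i N by auto
  then have "copula_of \<mu> (real i / real N) 1 - copula_of \<mu> ((real i - 1) / real N) 1 = 1 / real N"
    using i N by (simp add: copula_of_1 diff_divide_distrib)
  then show "cb_kernel N B u 1 = 1"
    using cb_kernel_bounds[OF B N i, of N 1] N by simp
qed

text \<open>By the defining identity of the kernel, the increment is its integral over {a<..b}, and
  the integrand stays within \<eta> of \<open>c\<close>.\<close>

lemma kernel_increment:
  assumes K: "continuous_markov_kernel_of \<mu> KA"
    and ab: "0 \<le> a" "a \<le> b" "b \<le> 1" and w: "w \<in> {0..1}"
    and close: "\<And>t. t \<in> {a<..b} \<Longrightarrow> \<bar>measure (KA t) {0..w} - c\<bar> \<le> \<eta>"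
  shows "\<bar>copula_of \<mu> b w - copula_of \<mu> a w - c * (b - a)\<bar> \<le> \<eta> * (b - a)"
proof -
  have mk: "markov_kernel_of \<mu> KA" and
    cont: "continuous_on ({0..1} \<times> {0..1}) (\<lambda>(x, y). measure (KA x) {0..y})"
    using K by (auto simp: continuous_markov_kernel_of_def)
  have E: "{a<..b} \<in> sets unit_borel" "{0..w} \<in> sets unit_borel"
    using ab w by (auto simp: sets_restrict_space_iff)
  have I: "(LINT x:{a<..b}|lborel. measure (KA x) {0..w}) = copula_of \<mu> b w - copula_of \<mu> a w"
    using mk E measure_Ioc_Icc[OF ab(2)] by (simp add: markov_kernel_of_def)
  \<comment> \<open>Continuity along the fixed level \<open>w\<close> makes the section integrable
    over the row.\<close>
  have "continuous_on {0..1} ((\<lambda>(x, y). measure (KA x) {0..y}) \<circ> (\<lambda>x. (x, w)))"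
    using w by (intro continuous_on_compose continuous_intros continuous_on_subset[OF cont]) auto
  then have "set_integrable lborel {0..1} (\<lambda>x. measure (KA x) {0..w})"
    by (intro borel_integrable_atLeastAtMost') (simp add: o_def)
  then have i: "set_integrable lborel {a<..b} (\<lambda>x. measure (KA x) {0..w})"
    by (rule set_integrable_subset) (use ab in auto)
  have ci: "set_integrable lborel {a<..b} (\<lambda>x. d)" for d :: real
    using ab by (simp add: set_integrable_def)
  have cI: "(LINT x:{a<..b}|lborel. d) = d * (b - a)" for d :: real
    using ab by (simp add: set_lebesgue_integral_def mult.commute)
  have "(LINT x:{a<..b}|lborel. c - \<eta>) \<le> (LINT x:{a<..b}|lborel. measure (KA x) {0..w})"
    using close by (intro set_integral_mono ci i) force
  moreover have "(LINT x:{a<..b}|lborel. measure (KA x) {0..w}) \<le> (LINT x:{a<..b}|lborel. c + \<eta>)"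
    using close by (intro set_integral_mono ci i) force
  ultimately show ?thesis
    unfolding I cI by (simp add: abs_le_iff algebra_simps)
qed

text \<open>The arguments move with k, as F_n(x) and G_n(y) do. The row around \<open>u k\<close>
  and the grid neighbours of \<open>v k\<close> shrink to the limit point, near which the kernel is
  almost constant; the error of the copula survives the scaling by N because
  \<open>N k * \<Delta> k\<close> tends to 0.\<close>

theorem cb_kernel_tendsto:
  assumes K: "continuous_markov_kernel_of \<mu> KA"
    and \<rho>: "\<And>k. doubly_stochastic (\<rho> k)" and B: "\<And>k. mu_of (B k) = \<rho> k"
    and N: "\<And>k. N k \<ge> 1" and N_top: "filterlim N at_top sequentially"
    and err: "eventually (\<lambda>k. \<forall>u\<in>{0..1}. \<forall>v\<in>{0..1}. \<bar>copula_of (\<rho> k) u v - copula_of \<mu> u v\<bar> \<le> \<Delta> k) sequentially"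
    and \<Delta>: "(\<lambda>k. real (N k) * \<Delta> k) \<longlonglongrightarrow> 0"
    and u: "\<And>k. u k \<in> {0..1}" "u \<longlonglongrightarrow> u0" and v: "\<And>k. v k \<in> {0..1}" "v \<longlonglongrightarrow> v0"
  shows "(\<lambda>k. cb_kernel (N k) (B k) (u k) (v k)) \<longlonglongrightarrow> measure (KA u0) {0..v0}"
proof (rule LIMSEQ_I)
  fix r :: real assume r: "r > 0"
  have uv0: "u0 \<in> {0..1}" "v0 \<in> {0..1}"
    using closed_sequentially[of "{0..1::real}" u u0] closed_sequentially[of "{0..1::real}" v v0] u v by auto
  have "uniformly_continuous_on ({0..1} \<times> {0..1}) (\<lambda>(x, y). measure (KA x) {0..y})"
    using K by (intro compact_uniformly_continuous compact_Times) (auto simp: continuous_markov_kernel_of_def)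
  then have "\<exists>d>0. \<forall>p\<in>{0..1} \<times> {0..1}. \<forall>p'\<in>{0..1} \<times> {0..1}. dist p' p < d \<longrightarrow>
      dist ((\<lambda>(x, y). measure (KA x) {0..y}) p') ((\<lambda>(x, y). measure (KA x) {0..y}) p) < r / 3"
    unfolding uniformly_continuous_on_def by (rule allE[of _ "r / 3"]) (use r in simp)
  then obtain \<delta> where \<delta>: "\<delta> > 0"
    and uc: "\<forall>p\<in>{0..1} \<times> {0..1}. \<forall>p'\<in>{0..1} \<times> {0..1}. dist p' p < \<delta> \<longrightarrow>
      dist ((\<lambda>(x, y). measure (KA x) {0..y}) p') ((\<lambda>(x, y). measure (KA x) {0..y}) p) < r / 3"
    by (elim exE conjE)
  have close: "\<bar>measure (KA t) {0..w} - measure (KA u0) {0..v0}\<bar> \<le> r / 3"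
    if "t \<in> {0..1}" "w \<in> {0..1}" "\<bar>t - u0\<bar> + \<bar>w - v0\<bar> < \<delta>" for t w
  proof -
    have "dist (t, w) (u0, v0) \<le> \<bar>t - u0\<bar> + \<bar>w - v0\<bar>"
      unfolding dist_prod_def by (simp add: dist_real_def sqrt_sum_squares_le_sum_abs)
    then have "dist (t, w) (u0, v0) < \<delta>" using that(3) by linarith
    then show ?thesis using uc[rule_format, of "(u0, v0)" "(t, w)"] that(1,2) uv0 by (simp add: dist_real_def)
  qed
  have "filterlim (\<lambda>k. real (N k)) at_top sequentially"
    by (rule filterlim_compose[OF filterlim_real_sequentially N_top])
  then have "(\<lambda>k. 1 / real (N k)) \<longlonglongrightarrow> 0"
    using tendsto_inverse_0_at_top by (simp add: inverse_eq_divide)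
  \<comment> \<open>Four distances have to add up to less than \<delta>: from \<open>t\<close> to
    \<open>u k\<close> and from \<open>w\<close> to \<open>v k\<close>, each at most 1/N, and from
    \<open>u k\<close> and \<open>v k\<close> to their limits.\<close>
  then have ev1: "eventually (\<lambda>k. 1 / real (N k) < \<delta> / 4) sequentially"
    using \<delta> by (intro order_tendstoD) auto
  have ev2: "eventually (\<lambda>k. \<bar>u k - u0\<bar> < \<delta> / 4) sequentially" "eventually (\<lambda>k. \<bar>v k - v0\<bar> < \<delta> / 4) sequentially"
    using tendstoD[OF u(2), of "\<delta> / 4"] tendstoD[OF v(2), of "\<delta> / 4"] \<delta> by (auto simp: dist_real_def)
  \<comment> \<open>An increment has two ends, so this error counts twice and gives r/3, next to r/3
    from continuity.\<close>
  have ev3: "eventually (\<lambda>k. real (N k) * \<Delta> k < r / 6) sequentially"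
    using \<Delta> r by (intro order_tendstoD) auto
  have "eventually (\<lambda>k. norm (cb_kernel (N k) (B k) (u k) (v k) - measure (KA u0) {0..v0}) < r) sequentially"
    using ev1 ev2 ev3 err
  proof eventually_elim
    case (elim k)
    interpret \<rho>: copula_measure "\<rho> k" by unfold_locales (rule \<rho>)
    define n where "n = N k"
    have n: "n \<ge> 1" "real n > 0" using N[of k] by (auto simp: n_def)
    obtain i where i: "i \<in> {1..n}" "u k \<in> cb_I n i" using cb_I_cover[OF n(1) u(1)] .
    define a where "a = (real i - 1) / real n"
    define b where "b = real i / real n"
    have ab: "0 \<le> a" "a \<le> b" "b \<le> 1" "b - a = 1 / real n"
      using i n by (auto simp: a_def b_def field_simps)
    have uk: "a \<le> u k" "u k \<le> b"
      using i by (auto simp: a_def b_def cb_I_def split: if_splits)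
    define p where "p = min (nat \<lfloor>real n * v k\<rfloor>) (n - 1)"
    have v01: "0 \<le> v k" "v k \<le> 1" using v(1)[of k] by auto
    note p = grid_position[OF n(1) v01, folded p_def]
    have pv: "real p / real n \<le> v k" "v k \<le> real (Suc p) / real n"
      using p n by (auto simp: field_simps)
    have bound: "\<bar>real n * (copula_of (\<rho> k) b (real m / real n) - copula_of (\<rho> k) a (real m / real n)) - measure (KA u0) {0..v0}\<bar> < r"
      if m: "m \<in> {p, Suc p}" for m
    proof -
      define w where "w = real m / real n"
      have w: "w \<in> {0..1}" using m p(1) n by (auto simp: w_def)
      have "real (Suc p) / real n = real p / real n + 1 / real n" by (simp add: add_divide_distrib)
      then have wv: "\<bar>w - v k\<bar> \<le> 1 / real n" using m pv by (auto simp: w_def)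
      have "\<bar>measure (KA t) {0..w} - measure (KA u0) {0..v0}\<bar> \<le> r / 3" if t: "t \<in> {a<..b}" for t
      proof (rule close)
        show "t \<in> {0..1}" using t ab by auto
        have "\<bar>t - u k\<bar> \<le> 1 / real n" using t uk ab by auto
        then show "\<bar>t - u0\<bar> + \<bar>w - v0\<bar> < \<delta>" using wv elim(1-3) unfolding n_def by linarith
      qed (rule w)
      from kernel_increment[OF K ab(1-3) w this]
      have "\<bar>copula_of \<mu> b w - copula_of \<mu> a w - measure (KA u0) {0..v0} / real n\<bar> \<le> (r / 3) / real n"
        by (simp add: ab(4))
      moreover have "\<bar>copula_of (\<rho> k) b w - copula_of \<mu> b w\<bar> \<le> \<Delta> k" "\<bar>copula_of (\<rho> k) a w - copula_of \<mu> a w\<bar> \<le> \<Delta> k"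
        using elim(5) w ab by auto
      ultimately have "\<bar>copula_of (\<rho> k) b w - copula_of (\<rho> k) a w - measure (KA u0) {0..v0} / real n\<bar> \<le> (r / 3) / real n + 2 * \<Delta> k"
        by linarith
      then have "real n * \<bar>copula_of (\<rho> k) b w - copula_of (\<rho> k) a w - measure (KA u0) {0..v0} / real n\<bar> \<le> real n * ((r / 3) / real n + 2 * \<Delta> k)"
        by (rule mult_left_mono) simp
      also have "\<dots> = r / 3 + 2 * (real n * \<Delta> k)" using n by (simp add: field_simps)
      also have "\<dots> < r" using elim(4) r by (simp add: n_def)
      also have "real n * \<bar>copula_of (\<rho> k) b w - copula_of (\<rho> k) a w - measure (KA u0) {0..v0} / real n\<bar> =
          \<bar>real n * (copula_of (\<rho> k) b w - copula_of (\<rho> k) a w) - measure (KA u0) {0..v0}\<bar>"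
      proof -
        have "real n * (copula_of (\<rho> k) b w - copula_of (\<rho> k) a w) - measure (KA u0) {0..v0} =
          real n * (copula_of (\<rho> k) b w - copula_of (\<rho> k) a w - measure (KA u0) {0..v0} / real n)"
          using n by (simp add: right_diff_distrib)
        then show ?thesis by (simp add: abs_mult)
      qed
      finally show ?thesis by (simp add: w_def)
    qed
    have "real n * (copula_of (\<rho> k) b (real p / real n) - copula_of (\<rho> k) a (real p / real n)) \<le> cb_kernel n (B k) (u k) (v k)"
      unfolding a_def b_def using p(1) pv by (intro \<rho>.cb_kernel_bounds(1)[OF B n(1) i]) auto
    moreover have "cb_kernel n (B k) (u k) (v k) \<le> real n * (copula_of (\<rho> k) b (real (Suc p) / real n) - copula_of (\<rho> k) a (real (Suc p) / real n))"
      unfolding a_def b_def using p(1) pv by (intro \<rho>.cb_kernel_bounds(2)[OF B n(1) i]) auto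
    ultimately show ?case
      using bound[of p] bound[of "Suc p"] unfolding n_def real_norm_def by (simp only: abs_less_iff) auto
  qed
  then show "\<exists>no. \<forall>k\<ge>no. norm (cb_kernel (N k) (B k) (u k) (v k) - measure (KA u0) {0..v0}) < r"
    by (simp add: eventually_sequentially)
qed

end

section \<open>Uniform deviations and the probability integral transform\<close>

context prob_space
begin

text \<open>Hoeffding's inequality for indicators, which range in [0, 1]: a deviation \<epsilon> of
  the mean is a deviation n \<epsilon> of the sum.\<close>

lemma empirical_measure_deviation:
  fixes Z :: "nat \<Rightarrow> 'a \<Rightarrow> 'b"
  assumes indep: "indep_vars (\<lambda>_. N) Z UNIV" and S [measurable]: "S \<in> sets N"
    and p: "\<And>i. prob {\<omega>\<in>space M. Z i \<omega> \<in> S} = p" and n: "n \<ge> 1" and \<epsilon>: "\<epsilon> \<ge> 0"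
  shows "prob {\<omega>\<in>space M. \<bar>real (card {i\<in>{..<n}. Z i \<omega> \<in> S}) / real n - p\<bar> \<ge> \<epsilon>} \<le> 2 * exp (-2 * real n * \<epsilon>\<^sup>2)"
proof -
  have [measurable]: "random_variable N (Z i)" for i
    using indep by (auto simp: indep_vars_def)
  define W where "W i \<omega> = (indicator S (Z i \<omega>) :: real)" for i \<omega>
  have "indep_vars (\<lambda>_. borel) W {..<n}"
    unfolding W_def by (rule indep_vars_compose2[OF indep_vars_subset[OF indep]]) auto
  then interpret Hoeffding_ineq M "{..<n}" W "\<lambda>_. 0" "\<lambda>_. 1" "\<Sum>i<n. expectation (W i)"
    by unfold_locales (auto simp: W_def indicator_def)
  have "expectation (W i) = p" for i
  proof -
    have "expectation (W i) = expectation (indicator {\<omega>\<in>space M. Z i \<omega> \<in> S})"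
      by (intro Bochner_Integration.integral_cong) (auto simp: W_def indicator_def)
    then show ?thesis using p by simp
  qed
  moreover have "(\<Sum>i<n. W i \<omega>) = real (card {i\<in>{..<n}. Z i \<omega> \<in> S})" for \<omega>
    unfolding W_def by (simp add: indicator_def sum.If_cases Int_def)
  moreover have scale: "real n * \<epsilon> \<le> \<bar>real (card {i\<in>{..<n}. Z i \<omega> \<in> S}) - real n * p\<bar> \<longleftrightarrow>
      \<epsilon> \<le> \<bar>real (card {i\<in>{..<n}. Z i \<omega> \<in> S}) / real n - p\<bar>" for \<omega>
  proof -
    have "real (card {i\<in>{..<n}. Z i \<omega> \<in> S}) - real n * p =
        real n * (real (card {i\<in>{..<n}. Z i \<omega> \<in> S}) / real n - p)"
      using n by (simp add: right_diff_distrib)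
    then show ?thesis using n by (simp add: abs_mult)
  qed
  ultimately have "prob {\<omega>\<in>space M. \<bar>real (card {i\<in>{..<n}. Z i \<omega> \<in> S}) - real n * p\<bar> \<ge> real n * \<epsilon>} \<le>
      2 * exp (-2 * (real n * \<epsilon>)\<^sup>2 / real n)"
    using Hoeffding_ineq_abs_ge[of "real n * \<epsilon>"] n \<epsilon> by simp
  also have "-2 * (real n * \<epsilon>)\<^sup>2 / real n = -2 * real n * \<epsilon>\<^sup>2"
    using n by (simp add: power2_eq_square)
  finally show ?thesis unfolding scale .
qed

text \<open>\<open>S\<close> depends on n because the grid does. The radius is chosen such that n
  times its square is \<open>real n powr c\<close>; the exponential then beats the (n + 1)^2 terms
  of the union bound for every c > 0.\<close>

lemma AE_empirical_grid:
  fixes Z :: "nat \<Rightarrow> 'a \<Rightarrow> 'b"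
  assumes indep: "indep_vars (\<lambda>_. N) Z UNIV" and S [measurable]: "\<And>n p q. S n p q \<in> sets N"
    and P: "\<And>i n p q. p \<le> n \<Longrightarrow> q \<le> n \<Longrightarrow> prob {\<omega>\<in>space M. Z i \<omega> \<in> S n p q} = P n p q"
    and c: "c > 0"
  shows "AE \<omega> in M. eventually (\<lambda>n. \<forall>p\<le>n. \<forall>q\<le>n.
    \<bar>real (card {i\<in>{..<n}. Z i \<omega> \<in> S n p q}) / real n - P n p q\<bar> \<le> real n powr ((c - 1) / 2)) sequentially"
proof -
  have [measurable]: "random_variable N (Z i)" for i
    using indep by (auto simp: indep_vars_def)
  define \<epsilon> where "\<epsilon> n = real n powr ((c - 1) / 2)" for n
  define A where "A n = (\<Union>(p, q)\<in>{..n} \<times> {..n}.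
    {\<omega>\<in>space M. \<bar>real (card {i\<in>{..<n}. Z i \<omega> \<in> S n p q}) / real n - P n p q\<bar> \<ge> \<epsilon> n})" for n
  have card_sum: "real (card {i\<in>{..<n}. Z i \<omega> \<in> T}) = (\<Sum>i<n. indicator T (Z i \<omega>))" for \<omega> n T
    by (simp add: indicator_def sum.If_cases Int_def)
  have ev [measurable]: "{\<omega>\<in>space M. \<bar>real (card {i\<in>{..<n}. Z i \<omega> \<in> S n p q}) / real n - P n p q\<bar> \<ge> \<epsilon> n} \<in> events" for n p q
    unfolding card_sum by measurable
  have A [measurable]: "A n \<in> events" for n
    unfolding A_def by (intro sets.finite_UN) auto
  have bound: "prob (A n) \<le> (real n + 1)\<^sup>2 * (2 * exp (-2 * real n powr c))" if "n \<ge> 1" for n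
  proof -
    have "prob (A n) \<le> (\<Sum>(p, q)\<in>{..n} \<times> {..n}.
        prob {\<omega>\<in>space M. \<bar>real (card {i\<in>{..<n}. Z i \<omega> \<in> S n p q}) / real n - P n p q\<bar> \<ge> \<epsilon> n})"
      unfolding A_def case_prod_unfold by (intro finite_measure_subadditive_finite) auto
    also have "\<dots> \<le> (\<Sum>(p, q)\<in>{..n} \<times> {..n}. 2 * exp (-2 * real n * (\<epsilon> n)\<^sup>2))"
      unfolding case_prod_unfold using that P
      by (intro sum_mono empirical_measure_deviation[OF indep]) (auto simp: \<epsilon>_def)
    also have "\<dots> = (real n + 1)\<^sup>2 * (2 * exp (-2 * real n * (\<epsilon> n)\<^sup>2))"
      by (simp add: power2_eq_square algebra_simps)
    also have "-2 * real n * (\<epsilon> n)\<^sup>2 = -2 * real n powr c"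
    proof -
      have "(\<epsilon> n)\<^sup>2 = real n powr (c - 1)"
        unfolding \<epsilon>_def power2_eq_square by (simp flip: powr_add)
      then show ?thesis by (simp add: powr_mult_base)
    qed
    finally show ?thesis .
  qed
  have "summable (\<lambda>n. prob (A n))"
  proof (rule summable_comparison_test_bigo)
    show "summable (\<lambda>n. norm (inverse (real n ^ 2)))"
      using inverse_power_summable[of 2, where 'a=real] by simp
    have "(\<lambda>n. prob (A n)) \<in> O(\<lambda>n. (real n + 1)\<^sup>2 * (2 * exp (-2 * real n powr c)))"
      using bound by (intro landau_o.big_mono eventually_sequentiallyI[of 1]) simp
    also have "(\<lambda>n. (real n + 1)\<^sup>2 * (2 * exp (-2 * real n powr c))) \<in> O(\<lambda>n. inverse (real n ^ 2))"
      using c by real_asymp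
    finally show "(\<lambda>n. prob (A n)) \<in> O(\<lambda>n. inverse (real n ^ 2))" .
  qed
  then have "AE \<omega> in M. eventually (\<lambda>n. \<omega> \<in> space M - A n) sequentially"
    by (intro borel_cantelli_AE1 A) (auto simp: emeasure_eq_measure)
  then show ?thesis
  proof eventually_elim
    case (elim \<omega>)
    then show ?case
    proof (eventually_elim, intro allI impI)
      fix n p q assume "\<omega> \<in> space M - A n" "p \<le> n" "q \<le> n"
      then have "\<not> \<epsilon> n \<le> \<bar>real (card {i\<in>{..<n}. Z i \<omega> \<in> S n p q}) / real n - P n p q\<bar>"
        unfolding A_def by auto
      then show "\<bar>real (card {i\<in>{..<n}. Z i \<omega> \<in> S n p q}) / real n - P n p q\<bar> \<le> real n powr ((c - 1) / 2)"
        unfolding \<epsilon>_def by linarith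
    qed
  qed
qed

text \<open>Fubini on the diagonal: for each value u of U, the independent V equals u with
  probability 0.\<close>

lemma AE_indep_neq:
  fixes U V :: "'a \<Rightarrow> real"
  assumes indep: "indep_var borel U borel V" and V: "\<And>a. prob {\<omega>\<in>space M. V \<omega> = a} = 0"
  shows "AE \<omega> in M. U \<omega> \<noteq> V \<omega>"
proof -
  have [measurable]: "random_variable borel U" "random_variable borel V"
    using indep by (auto simp: indep_var_distribution_eq)
  interpret U: prob_space "distr M borel U" by (rule prob_space_distr) measurable
  interpret V: prob_space "distr M borel V" by (rule prob_space_distr) measurable
  let ?D = "{p :: real \<times> real. fst p = snd p}"
  have "closed ?D" by (intro closed_Collect_eq continuous_intros)
  from borel_closed[OF this] have D: "?D \<in> sets (borel \<Otimes>\<^sub>M borel)" by (simp only: borel_prod)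
  have "emeasure M {\<omega>\<in>space M. U \<omega> = V \<omega>} = emeasure (distr M (borel \<Otimes>\<^sub>M borel) (\<lambda>\<omega>. (U \<omega>, V \<omega>))) ?D"
    using D by (subst emeasure_distr) (auto intro!: arg_cong[where f="emeasure M"])
  also have "distr M (borel \<Otimes>\<^sub>M borel) (\<lambda>\<omega>. (U \<omega>, V \<omega>)) = distr M borel U \<Otimes>\<^sub>M distr M borel V"
    using indep by (simp add: indep_var_distribution_eq)
  also have "emeasure \<dots> ?D = (\<integral>\<^sup>+u. emeasure (distr M borel V) (Pair u -` ?D) \<partial>distr M borel U)"
    using D by (intro V.emeasure_pair_measure_alt) simp
  also have "\<dots> = (\<integral>\<^sup>+u. 0 \<partial>distr M borel U)"
  proof (intro nn_integral_cong)
    fix u :: real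
    have "Pair u -` ?D = {u}" by auto
    then have "emeasure (distr M borel V) (Pair u -` ?D) = emeasure M (V -` {u} \<inter> space M)"
      by (simp add: emeasure_distr)
    also have "V -` {u} \<inter> space M = {\<omega>\<in>space M. V \<omega> = u}" by auto
    finally show "emeasure (distr M borel V) (Pair u -` ?D) = 0"
      using V[of u] by (simp add: emeasure_eq_measure)
  qed
  finally have "emeasure M {\<omega>\<in>space M. U \<omega> = V \<omega>} = 0" by simp
  then show ?thesis
    by (intro AE_I'[of "{\<omega>\<in>space M. U \<omega> = V \<omega>}"]) (auto simp: null_sets_def)
qed

text \<open>The mass of {a} x (-oo, b] is at most H(a, b) - H(a - d, b), which vanishes with d;
  countably many b exhaust the line over a.\<close>

lemma prob_eq_0_of_joint_cdf_continuous:
  fixes X Y :: "'a \<Rightarrow> real"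
  assumes [measurable]: "random_variable borel X" "random_variable borel Y"
    and H: "continuous_on UNIV (\<lambda>(a, b). prob {\<omega>\<in>space M. X \<omega> \<le> a \<and> Y \<omega> \<le> b})"
  shows "prob {\<omega>\<in>space M. X \<omega> = a} = 0"
proof -
  define h where "h a b = prob {\<omega>\<in>space M. X \<omega> \<le> a \<and> Y \<omega> \<le> b}" for a b
  have null: "prob {\<omega>\<in>space M. X \<omega> = a \<and> Y \<omega> \<le> b} = 0" for b
  proof -
    have le: "prob {\<omega>\<in>space M. X \<omega> = a \<and> Y \<omega> \<le> b} \<le> h a b - h (a - d) b" if d: "d > 0" for d
    proof -
      have "prob {\<omega>\<in>space M. X \<omega> = a \<and> Y \<omega> \<le> b} \<le>
          prob ({\<omega>\<in>space M. X \<omega> \<le> a \<and> Y \<omega> \<le> b} - {\<omega>\<in>space M. X \<omega> \<le> a - d \<and> Y \<omega> \<le> b})"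
        using d by (intro finite_measure_mono) auto
      also have "\<dots> = h a b - h (a - d) b"
        unfolding h_def using d by (intro finite_measure_Diff) auto
      finally show ?thesis .
    qed
    have "continuous_on UNIV (\<lambda>a. (\<lambda>(a, b). h a b) (a, b))"
      by (rule continuous_on_compose2[OF H[folded h_def]]) (auto intro!: continuous_intros)
    then have "isCont (\<lambda>a. h a b) a" by (simp add: continuous_on_eq_continuous_at)
    moreover have "(\<lambda>k. a - inverse (real (Suc k))) \<longlonglongrightarrow> a - 0"
      by (intro tendsto_intros LIMSEQ_inverse_real_of_nat)
    ultimately have "(\<lambda>k. h (a - inverse (real (Suc k))) b) \<longlonglongrightarrow> h a b"
      by (intro isCont_tendsto_compose[where g="\<lambda>a. h a b"]) auto
    then have "(\<lambda>k. h a b - h (a - inverse (real (Suc k))) b) \<longlonglongrightarrow> h a b - h a b"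
      by (intro tendsto_intros)
    then have "prob {\<omega>\<in>space M. X \<omega> = a \<and> Y \<omega> \<le> b} \<le> h a b - h a b"
      by (rule LIMSEQ_le_const) (intro exI allI impI le, simp)
    then show ?thesis by (simp add: measure_le_0_iff)
  qed
  have "AE \<omega> in M. \<forall>m. \<not> (X \<omega> = a \<and> Y \<omega> \<le> real m)"
    unfolding AE_all_countable
  proof
    fix m :: nat
    show "AE \<omega> in M. \<not> (X \<omega> = a \<and> Y \<omega> \<le> real m)"
      using null[of "real m"] by (intro AE_I'[of "{\<omega>\<in>space M. X \<omega> = a \<and> Y \<omega> \<le> real m}"])
        (auto simp: null_sets_def emeasure_eq_measure)
  qed
  then have "AE \<omega> in M. \<omega> \<notin> {\<omega>\<in>space M. X \<omega> = a}"
    by eventually_elim (use real_arch_simple in blast)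
  then show ?thesis
    using prob_eq_0[of "{\<omega>\<in>space M. X \<omega> = a}"] by simp
qed

section \<open>The probability integral transform of a variable without atoms\<close>

context
  fixes X :: "'a \<Rightarrow> real" and F :: "real \<Rightarrow> real"
  assumes X [measurable]: "random_variable borel X"
    and F: "\<And>a. F a = prob {\<omega>\<in>space M. X \<omega> \<le> a}"
    and no_atoms: "\<And>a. prob {\<omega>\<in>space M. X \<omega> = a} = 0"
begin

lemma distribution_fun_mono: "mono F"
  unfolding F by (intro monoI finite_measure_mono) auto

lemma distribution_fun_cdf: "F = cdf (distr M borel X)"
  by (rule ext) (auto simp: F cdf_def measure_distr intro!: arg_cong[where f=prob])

lemma distribution_fun_continuous: "continuous_on UNIV F"
proof -
  interpret D: real_distribution "distr M borel X" by simp
  have "measure (distr M borel X) {a} = 0" for a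
    using no_atoms[of a] by (simp add: measure_distr vimage_def Int_def conj_commute)
  then show ?thesis
    unfolding distribution_fun_cdf continuous_on_eq_continuous_at[OF open_UNIV] D.isCont_cdf by simp
qed

text \<open>If F is flat at height u, only the right end of the flat piece makes the equivalence
  true, so \<open>a\<close> is the supremum of the closed set where F is at most u. To the right of
  \<open>a\<close> the values exceed u, and continuity gives F a \<ge> u.\<close>

lemma distribution_fun_level:
  assumes "0 < u" "u < 1"
  obtains a where "F a = u" "\<forall>t. F t \<le> u \<longleftrightarrow> t \<le> a"
proof -
  interpret D: real_distribution "distr M borel X" by simp
  have "eventually (\<lambda>t. F t < u) at_bot" "eventually (\<lambda>t. F t > u) at_top"
    unfolding distribution_fun_cdf using assms
    by (auto intro!: order_tendstoD D.cdf_lim_at_bot D.cdf_lim_at_top_prob)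
  then obtain l h where l: "F l < u" and h: "F h > u"
    by (auto simp: eventually_at_bot_linorder eventually_at_top_linorder)
  define S where "S = {t. F t \<le> u}"
  have "closed (F -` {..u})"
    using distribution_fun_continuous by (intro closed_vimage) auto
  then have cl: "closed S" by (simp add: S_def vimage_def)
  have ne: "S \<noteq> {}" using l by (auto simp: S_def intro: less_imp_le)
  have bd: "t \<le> h" if "t \<in> S" for t
  proof (rule ccontr)
    assume "\<not> t \<le> h"
    then have "F h \<le> F t" using monoD[OF distribution_fun_mono, of h t] by simp
    then show False using h that by (simp add: S_def)
  qed
  then have bdd: "bdd_above S" by (rule bdd_aboveI)
  define a where "a = Sup S"
  have aS: "a \<in> S" unfolding a_def by (rule closed_contains_Sup[OF ne bdd cl])
  have iff: "F t \<le> u \<longleftrightarrow> t \<le> a" for t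
  proof
    assume "F t \<le> u"
    then show "t \<le> a" unfolding a_def by (intro cSup_upper bdd) (simp add: S_def)
  next
    assume "t \<le> a"
    then have "F t \<le> F a" by (rule monoD[OF distribution_fun_mono])
    then show "F t \<le> u" using aS by (simp add: S_def)
  qed
  have "u \<le> F a"
  proof (rule tendsto_lowerbound)
    show "(F \<longlongrightarrow> F a) (at_right a)"
      using distribution_fun_continuous
      by (auto simp: continuous_on_eq_continuous_at isCont_def intro: tendsto_mono[OF at_le])
    show "eventually (\<lambda>t. u \<le> F t) (at_right a)"
      using eventually_at_right_less[of a] by eventually_elim (metis iff linorder_not_le less_imp_le)
  qed simp
  with iff[of a] have "F a = u" by simp
  with iff show ?thesis by (intro that) auto
qed

text \<open>For 0 < u < 1 the event is that X is at most the level from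
  \<open>distribution_fun_level\<close>. The heights 0 and 1 need not be attained by F and are
  treated separately.\<close>

lemma prob_integral_transform:
  assumes "u \<in> {0..1}"
  shows "prob {\<omega>\<in>space M. F (X \<omega>) \<le> u} = u"
proof -
  have [measurable]: "F \<in> borel_measurable borel"
    by (rule borel_measurable_mono[OF distribution_fun_mono])
  have inner: "prob {\<omega>\<in>space M. F (X \<omega>) \<le> u} = u" if u: "0 < u" "u < 1" for u
  proof -
    obtain a where a: "F a = u" "\<forall>t. F t \<le> u \<longleftrightarrow> t \<le> a"
      by (rule distribution_fun_level[OF u])
    show ?thesis using a F[of a] by simp
  qed
  consider "u = 0" | "0 < u" "u < 1" | "u = 1" using assms by fastforce
  then show ?thesis
  proof cases
    case 1
    \<comment> \<open>The event is contained in the one for each small e > 0, whose probability is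
      e.\<close>
    have "prob {\<omega>\<in>space M. F (X \<omega>) \<le> 0} \<le> 0"
    proof (rule dense_ge_bounded[of 0 1])
      fix e :: real assume e: "0 < e" "e < 1"
      have "prob {\<omega>\<in>space M. F (X \<omega>) \<le> 0} \<le> prob {\<omega>\<in>space M. F (X \<omega>) \<le> e}"
        using e by (intro finite_measure_mono) auto
      then show "prob {\<omega>\<in>space M. F (X \<omega>) \<le> 0} \<le> e" using inner[OF e] by simp
    qed simp
    then show ?thesis using 1 by (simp add: measure_le_0_iff)
  next
    case 3
    have "F t \<le> 1" for t by (simp add: F)
    then show ?thesis using 3 prob_space by simp
  qed (rule inner)
qed

text \<open>Up to truncation at 0, the event lies in {u - e < F(X) \<le> u}, of probability e.
  Together with independence this excludes ties in the transformed sample.\<close>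

lemma prob_integral_transform_no_atoms: "prob {\<omega>\<in>space M. F (X \<omega>) = u} = 0"
proof (cases "u \<in> {0..1}")
  case False
  have "0 \<le> F t" "F t \<le> 1" for t by (simp_all add: F)
  then have "{\<omega>\<in>space M. F (X \<omega>) = u} = {}" using False by auto
  then show ?thesis by (simp only: measure_empty)
next
  case u: True
  have [measurable]: "F \<in> borel_measurable borel"
    by (rule borel_measurable_mono[OF distribution_fun_mono])
  have "prob {\<omega>\<in>space M. F (X \<omega>) = u} \<le> 0"
  proof (rule field_le_epsilon)
    fix e :: real assume e: "e > 0"
    show "prob {\<omega>\<in>space M. F (X \<omega>) = u} \<le> 0 + e"
    proof (cases "u - e \<ge> 0")
      case True
      have "prob {\<omega>\<in>space M. F (X \<omega>) = u} \<le> prob ({\<omega>\<in>space M. F (X \<omega>) \<le> u} - {\<omega>\<in>space M. F (X \<omega>) \<le> u - e})"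
        using e by (intro finite_measure_mono) auto
      also have "\<dots> = prob {\<omega>\<in>space M. F (X \<omega>) \<le> u} - prob {\<omega>\<in>space M. F (X \<omega>) \<le> u - e}"
        using e by (intro finite_measure_Diff) auto
      also have "\<dots> = u - (u - e)"
        using u e True prob_integral_transform[of u] prob_integral_transform[of "u - e"] by simp
      finally show ?thesis by simp
    next
      case False
      have "prob {\<omega>\<in>space M. F (X \<omega>) = u} \<le> prob {\<omega>\<in>space M. F (X \<omega>) \<le> u}"
        by (intro finite_measure_mono) auto
      then show ?thesis using prob_integral_transform[OF u] False by simp
    qed
  qed
  then show ?thesis by (simp add: measure_le_0_iff)
qed

end

end

section \<open>The empirical conditional distribution function\<close>

lemma emp_F_range: "n \<ge> 1 \<Longrightarrow> emp_F Z n \<omega> z \<in> {0..1}"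
  using card_mono[of "{..<n}" "{i\<in>{..<n}. Z i \<omega> \<le> z}"] by (auto simp: emp_F_def)

lemma emp_F_mono:
  assumes "z \<le> z'"
  shows "emp_F Z n \<omega> z \<le> emp_F Z n \<omega> z'"
proof -
  have "card {i\<in>{..<n}. Z i \<omega> \<le> z} \<le> card {i\<in>{..<n}. Z i \<omega> \<le> z'}"
    using assms by (intro card_mono) auto
  then show ?thesis unfolding emp_F_def by (intro divide_right_mono) auto
qed

text \<open>There are finitely many jumps, so none lies immediately to the right of z. Any function
  of \<open>emp_F\<close> is therefore right continuous.\<close>

lemma emp_F_at_right: "eventually (\<lambda>z'. emp_F Z n \<omega> z' = emp_F Z n \<omega> z) (at_right z)"
proof -
  have "eventually (\<lambda>z'. \<forall>i\<in>{..<n}. Z i \<omega> \<le> z' \<longleftrightarrow> Z i \<omega> \<le> z) (at_right z)"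
  proof (rule eventually_ball_finite, simp, rule ballI)
    fix i
    show "eventually (\<lambda>z'. Z i \<omega> \<le> z' \<longleftrightarrow> Z i \<omega> \<le> z) (at_right z)"
    proof (cases "Z i \<omega> \<le> z")
      case True
      then show ?thesis
        using eventually_at_right_less[of z] by (auto elim!: eventually_mono)
    next
      case False
      then have "eventually (\<lambda>z'. z' < Z i \<omega>) (at_right z)"
        by (intro order_tendstoD(2)[OF tendsto_ident_at]) auto
      then show ?thesis using False by (auto elim!: eventually_mono)
    qed
  qed
  then show ?thesis
  proof eventually_elim
    case (elim z')
    then have "{i\<in>{..<n}. Z i \<omega> \<le> z'} = {i\<in>{..<n}. Z i \<omega> \<le> z}" by blast
    then show ?case by (simp add: emp_F_def)
  qed
qed

lemma emp_F_at_bot: "eventually (\<lambda>z. emp_F Z n \<omega> z = 0) at_bot"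
proof -
  have "eventually (\<lambda>z. \<forall>i\<in>{..<n}. z < Z i \<omega>) at_bot"
    by (intro eventually_ball_finite ballI eventually_gt_at_bot) simp
  then show ?thesis
  proof eventually_elim
    case (elim z)
    then have "{i\<in>{..<n}. Z i \<omega> \<le> z} = {}" by force
    then show ?case by (simp add: emp_F_def)
  qed
qed

lemma emp_F_at_top:
  assumes "n \<ge> 1"
  shows "eventually (\<lambda>z. emp_F Z n \<omega> z = 1) at_top"
proof -
  have "eventually (\<lambda>z. \<forall>i\<in>{..<n}. Z i \<omega> \<le> z) at_top"
    by (intro eventually_ball_finite ballI eventually_ge_at_top) simp
  then show ?thesis
  proof eventually_elim
    case (elim z)
    then have "{i\<in>{..<n}. Z i \<omega> \<le> z} = {..<n}" by auto
    then show ?case using assms by (simp add: emp_F_def)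
  qed
qed

text \<open>Makes \<open>interval_measure D\<close> a probability measure with distribution function
  \<open>D\<close>, to which uniform integrability can be applied. All limits are attained, since
  \<open>emp_F\<close> is eventually constant in each of them.\<close>

lemma cb_kernel_emp_df:
  fixes Y :: "nat \<Rightarrow> 'a \<Rightarrow> real" and \<omega> :: 'a
  assumes \<mu>: "doubly_stochastic (mu_of B)" and N: "N \<ge> 1" and n: "n \<ge> 1" and u: "u \<in> {0..1}"
  defines "D \<equiv> \<lambda>y. cb_kernel N B u (emp_F Y n \<omega> y)"
  shows "mono D" "continuous (at_right a) D" "(D \<longlongrightarrow> 0) at_bot" "(D \<longlongrightarrow> 1) at_top"
proof -
  interpret copula_measure "mu_of B" by unfold_locales (rule \<mu>)
  note K01 = cb_kernel_0_1[OF refl N u]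
  show "mono D" unfolding D_def by (intro monoI cb_kernel_mono emp_F_mono)
  have "eventually (\<lambda>y. D y = D a) (at_right a)"
    using emp_F_at_right[of Y n \<omega> a] by eventually_elim (simp add: D_def)
  then show "continuous (at_right a) D"
    unfolding continuous_within by (rule tendsto_eventually)
  have "eventually (\<lambda>y. D y = 0) at_bot"
    using emp_F_at_bot[of Y n \<omega>] by eventually_elim (simp add: D_def K01)
  then show "(D \<longlongrightarrow> 0) at_bot" by (rule tendsto_eventually)
  have "eventually (\<lambda>y. D y = 1) at_top"
    using emp_F_at_top[OF n, of Y \<omega>] by eventually_elim (simp add: D_def K01)
  then show "(D \<longlongrightarrow> 1) at_top" by (rule tendsto_eventually)
qed

lemma rank_measure_cong:
  assumes "\<And>k. k < n \<Longrightarrow> r k = r' k" "\<And>k. k < n \<Longrightarrow> s k = s' k"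
  shows "rank_measure n r s = rank_measure n r' s'"
  unfolding rank_measure_def using assms by (intro arg_cong2[where f=density] refl ext sum.cong) auto

context uniform_sample
begin

text \<open>One 1/n comes from \<open>marginal_err\<close>, the other from the single sample point
  beyond z that F may map to \<open>F z\<close>. \<open>W\<close> is either coordinate.\<close>

lemma emp_F_err:
  assumes "mono F" "\<And>k. W k = F (Z k \<omega>)" "inj_on W {..<n}" "F z \<in> {0..1}" and W: "W = U \<or> W = V"
  shows "\<bar>emp_F Z n \<omega> z - F z\<bar> \<le> \<epsilon> + 2 / real n"
proof -
  have inj: "inj_on (\<lambda>k. F (Z k \<omega>)) {..<n}" using assms(2,3) by (simp add: inj_on_def)
  let ?c = "real (card {k\<in>{..<n}. W k \<le> F z}) / real n"
  have "\<bar>?c - F z\<bar> \<le> \<epsilon> + 1 / real n"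
    using W marginal_err[OF assms(4)] by auto
  moreover have "emp_F Z n \<omega> z \<le> ?c" "?c \<le> emp_F Z n \<omega> z + 1 / real n"
  proof -
    show "emp_F Z n \<omega> z \<le> ?c"
      unfolding emp_F_def assms(2) using card_le_comp_mono(1)[OF assms(1) inj, of z]
      by (intro divide_right_mono) auto
    have "?c \<le> real (Suc (card {k\<in>{..<n}. Z k \<omega> \<le> z})) / real n"
      unfolding assms(2) using card_le_comp_mono(2)[OF assms(1) inj, of z]
      by (intro divide_right_mono) (auto simp del: of_nat_Suc)
    then show "?c \<le> emp_F Z n \<omega> z + 1 / real n" by (simp add: emp_F_def add_divide_distrib)
  qed
  ultimately show ?thesis by linarith
qed

end

lemma nat_floor_powr_ge_1:
  assumes "n \<ge> 1" "s \<ge> 0"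
  shows "nat \<lfloor>real n powr s\<rfloor> \<ge> 1"
proof -
  have "1 \<le> real n powr s" using assms by (intro ge_one_powr_ge_zero) auto
  then have "1 \<le> \<lfloor>real n powr s\<rfloor>" by simp
  then show ?thesis by linarith
qed

text \<open>The exponent \<open>(1 / 2 - s - 1) / 2 = - (s + 1 / 2) / 2\<close> lies strictly between \<open>- 1 / 2\<close>, so that Hoeffding's
  bound stays summable, and \<open>- s\<close>, so that the error survives multiplication by \<open>n powr s\<close>. The
  index starts at \<open>Suc n\<close> because everything is a junk value (a division by zero) for \<open>0\<close>.\<close>

theorem emp_cb_kernel_tendsto:
  fixes X Y :: "nat \<Rightarrow> 'a \<Rightarrow> real" and \<omega> :: 'a and F G :: "real \<Rightarrow> real"
  assumes \<mu>: "doubly_stochastic \<mu>" and K: "continuous_markov_kernel_of \<mu> KA"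
    and s: "0 < s" "s < 1 / 2"
    and F: "mono F" "\<And>t. F t \<in> {0..1}" and G: "mono G" "\<And>t. G t \<in> {0..1}"
    and inj: "inj (\<lambda>k. F (X k \<omega>))" "inj (\<lambda>k. G (Y k \<omega>))"
    and err: "eventually (\<lambda>n. \<forall>p\<le>n. \<forall>q\<le>n.
      \<bar>real (card {k\<in>{..<n}. F (X k \<omega>) \<le> real p / real n \<and> G (Y k \<omega>) \<le> real q / real n}) / real n
        - copula_of \<mu> (real p / real n) (real q / real n)\<bar> \<le> real n powr ((1 / 2 - s - 1) / 2)) sequentially"
  shows "(\<lambda>n. cb_kernel (nat \<lfloor>real (Suc n) powr s\<rfloor>) (emp_copula X Y (Suc n) \<omega>) (emp_F X (Suc n) \<omega> x) (emp_F Y (Suc n) \<omega> y))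
    \<longlonglongrightarrow> measure (KA (F x)) {0..G y}"
proof -
  let ?U = "\<lambda>k. F (X k \<omega>)" and ?V = "\<lambda>k. G (Y k \<omega>)"
  define \<epsilon> where "\<epsilon> n = real n powr ((1 / 2 - s - 1) / 2)" for n
  have injn: "inj_on ?U {..<n}" "inj_on ?V {..<n}" for n
    using inj by (auto intro: inj_on_subset)
  have injX: "inj_on (\<lambda>k. X k \<omega>) {..<n}" "inj_on (\<lambda>k. Y k \<omega>) {..<n}" for n
    using injn[of n] by (auto simp: inj_on_def)
  have err': "eventually (\<lambda>n. uniform_sample \<mu> ?U ?V (Suc n) (\<epsilon> (Suc n))) sequentially"
  proof -
    have "eventually (\<lambda>n. \<forall>p\<le>Suc n. \<forall>q\<le>Suc n.
      \<bar>real (card {k\<in>{..<Suc n}. ?U k \<le> real p / real (Suc n) \<and> ?V k \<le> real q / real (Suc n)}) / real (Suc n)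
        - copula_of \<mu> (real p / real (Suc n)) (real q / real (Suc n))\<bar> \<le> \<epsilon> (Suc n)) sequentially"
      using err unfolding \<epsilon>_def by (rule eventually_compose_filterlim) (rule filterlim_Suc)
    then show ?thesis
    proof eventually_elim
      case (elim n)
      show ?case
      proof (unfold_locales)
        show "doubly_stochastic \<mu>" by (rule \<mu>)
        show "inj_on ?U {..<Suc n}" "inj_on ?V {..<Suc n}" by (rule injn)+
        show "?U k \<le> 1" "?V k \<le> 1" for k using F(2) G(2) by auto
      qed (use elim in auto)
    qed
  qed
  define \<rho> where "\<rho> n = mu_of (emp_copula X Y (Suc n) \<omega>)" for n
  have \<rho>: "doubly_stochastic (\<rho> n)"
    "\<rho> n = rank_measure (Suc n) (sample_rank ?U (Suc n)) (sample_rank ?V (Suc n))" for n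
  proof -
    note mu = emp_copula_mu_of[where X=X and Y=Y and \<omega>=\<omega> and n="Suc n", OF _ injX, simplified]
    show "doubly_stochastic (\<rho> n)" unfolding \<rho>_def mu(2) by (rule mu(1))
    \<comment> \<open>E_n is built from the original sample, the error bounds concern the
      transformed one; equal ranks identify the two measures.\<close>
    show "\<rho> n = rank_measure (Suc n) (sample_rank ?U (Suc n)) (sample_rank ?V (Suc n))"
      unfolding \<rho>_def mu(2)
      by (intro rank_measure_cong rank_comp_mono[symmetric] F(1) G(1) injn)
  qed
  have \<epsilon>0: "(\<lambda>n. \<epsilon> (Suc n) + 2 / real (Suc n)) \<longlonglongrightarrow> 0"
  proof -
    have "(\<lambda>n. real (Suc n) powr ((1 / 2 - s - 1) / 2)) \<longlonglongrightarrow> 0"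
      using s by (intro tendsto_neg_powr filterlim_compose[OF filterlim_real_sequentially filterlim_Suc]) auto
    moreover have "(\<lambda>n. 2 / real (Suc n)) \<longlonglongrightarrow> 0" by real_asymp
    ultimately show ?thesis unfolding \<epsilon>_def by (auto intro: tendsto_add_zero)
  qed
  have emp: "(\<lambda>n. emp_F X (Suc n) \<omega> x) \<longlonglongrightarrow> F x" "(\<lambda>n. emp_F Y (Suc n) \<omega> y) \<longlonglongrightarrow> G y"
  proof -
    have "eventually (\<lambda>n. \<bar>emp_F X (Suc n) \<omega> x - F x\<bar> \<le> \<epsilon> (Suc n) + 2 / real (Suc n)) sequentially"
      using err'
    proof eventually_elim
      case (elim n)
      interpret uniform_sample \<mu> ?U ?V "Suc n" "\<epsilon> (Suc n)" by (rule elim)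
      show ?case by (rule emp_F_err[where W="?U"]) (use F injn in auto)
    qed
    then have "(\<lambda>n. emp_F X (Suc n) \<omega> x - F x) \<longlonglongrightarrow> 0"
      unfolding real_norm_def[symmetric] by (rule Lim_null_comparison) (rule \<epsilon>0)
    then show "(\<lambda>n. emp_F X (Suc n) \<omega> x) \<longlonglongrightarrow> F x" by (rule LIM_zero_cancel)
    have "eventually (\<lambda>n. \<bar>emp_F Y (Suc n) \<omega> y - G y\<bar> \<le> \<epsilon> (Suc n) + 2 / real (Suc n)) sequentially"
      using err'
    proof eventually_elim
      case (elim n)
      interpret uniform_sample \<mu> ?U ?V "Suc n" "\<epsilon> (Suc n)" by (rule elim)
      show ?case by (rule emp_F_err[where W="?V"]) (use G injn in auto)
    qed
    then have "(\<lambda>n. emp_F Y (Suc n) \<omega> y - G y) \<longlonglongrightarrow> 0"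
      unfolding real_norm_def[symmetric] by (rule Lim_null_comparison) (rule \<epsilon>0)
    then show "(\<lambda>n. emp_F Y (Suc n) \<omega> y) \<longlonglongrightarrow> G y" by (rule LIM_zero_cancel)
  qed
  let ?N = "\<lambda>n. nat \<lfloor>real (Suc n) powr s\<rfloor>" and ?\<Delta> = "\<lambda>n. 3 * \<epsilon> (Suc n) + 2 / real (Suc n)"
  interpret copula_measure \<mu> by unfold_locales (rule \<mu>)
  show ?thesis
  proof (rule cb_kernel_tendsto[where \<rho>=\<rho> and \<Delta>="?\<Delta>", OF K \<rho>(1)])
    show "?N n \<ge> 1" for n using s by (intro nat_floor_powr_ge_1) auto
    have "filterlim (\<lambda>n. real (Suc n) powr s) at_top sequentially" using s by real_asymp
    then show "filterlim ?N at_top sequentially"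
      by (intro filterlim_compose[OF filterlim_nat_sequentially] filterlim_compose[OF filterlim_floor_sequentially])
    show "eventually (\<lambda>n. \<forall>u\<in>{0..1}. \<forall>v\<in>{0..1}. \<bar>copula_of (\<rho> n) u v - copula_of \<mu> u v\<bar> \<le> ?\<Delta> n) sequentially"
      using err'
    proof eventually_elim
      case (elim n)
      interpret uniform_sample \<mu> ?U ?V "Suc n" "\<epsilon> (Suc n)" by (rule elim)
      show ?case unfolding \<rho>(2) by (intro ballI rank_measure_err)
    qed
    have "(\<lambda>n. real (Suc n) powr s * ?\<Delta> n) \<longlonglongrightarrow> 0"
    proof -
      \<comment> \<open>Both exponents are negative: the first because s < 1/2, the second, due to
        interpolation, because s < 1.\<close>
      have "real (Suc n) powr s * ?\<Delta> n = 3 * real (Suc n) powr (s / 2 - 1 / 4) + 2 * real (Suc n) powr (s - 1)" for n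
      proof -
        have "s + (1 / 2 - s - 1) / 2 = s / 2 - 1 / 4" by (simp add: field_simps)
        then have "real (Suc n) powr s * \<epsilon> (Suc n) = real (Suc n) powr (s / 2 - 1 / 4)"
          unfolding \<epsilon>_def by (simp only: powr_add[symmetric])
        moreover have "real (Suc n) powr s * (2 / real (Suc n)) = 2 * real (Suc n) powr (s - 1)"
          by (simp add: powr_diff)
        ultimately show ?thesis by (simp add: distrib_left)
      qed
      moreover have "(\<lambda>n. 3 * real (Suc n) powr (s / 2 - 1 / 4) + 2 * real (Suc n) powr (s - 1)) \<longlonglongrightarrow> 3 * 0 + 2 * 0"
        using s by (intro tendsto_intros tendsto_neg_powr filterlim_compose[OF filterlim_real_sequentially filterlim_Suc]) auto
      ultimately show ?thesis by simp
    qed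
    then show "(\<lambda>n. real (?N n) * ?\<Delta> n) \<longlonglongrightarrow> 0"
    proof (rule Lim_null_comparison[rotated], intro always_eventually allI)
      fix n
      have "0 \<le> ?\<Delta> n" by (simp add: \<epsilon>_def)
      moreover have "real (?N n) \<le> real (Suc n) powr s" by simp
      ultimately have "real (?N n) * ?\<Delta> n \<le> real (Suc n) powr s * ?\<Delta> n" by (rule mult_right_mono[rotated])
      then show "norm (real (?N n) * ?\<Delta> n) \<le> real (Suc n) powr s * ?\<Delta> n"
        using \<open>0 \<le> ?\<Delta> n\<close> by (simp add: abs_mult)
    qed
    show "emp_F X (Suc n) \<omega> x \<in> {0..1}" "emp_F Y (Suc n) \<omega> y \<in> {0..1}" for n
      by (rule emp_F_range, simp)+
  qed (use emp in \<open>auto simp: \<rho>_def\<close>)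
qed

text \<open>For interior u and v the event is {X \<le> a, Y \<le> b} for suitable levels, and
  \<open>H\<close> evaluates it. On the boundary of the square such levels may be missing, but there
  the copula is 0 or a marginal.\<close>

lemma (in prob_space) prob_integral_transform_joint:
  fixes X Y :: "'a \<Rightarrow> real"
  assumes [measurable]: "random_variable borel X" "random_variable borel Y"
    and F: "\<And>a. F a = prob {\<omega>\<in>space M. X \<omega> \<le> a}" and G: "\<And>a. G a = prob {\<omega>\<in>space M. Y \<omega> \<le> a}"
    and X0: "\<And>a. prob {\<omega>\<in>space M. X \<omega> = a} = 0" and Y0: "\<And>a. prob {\<omega>\<in>space M. Y \<omega> = a} = 0"
    and \<mu>: "doubly_stochastic \<mu>"
    and H: "\<And>a b. prob {\<omega>\<in>space M. X \<omega> \<le> a \<and> Y \<omega> \<le> b} = copula_of \<mu> (F a) (G b)"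
    and u: "u \<in> {0..1}" and v: "v \<in> {0..1}"
  shows "prob {\<omega>\<in>space M. F (X \<omega>) \<le> u \<and> G (Y \<omega>) \<le> v} = copula_of \<mu> u v"
proof -
  interpret \<mu>: copula_measure \<mu> by unfold_locales (rule \<mu>)
  have [measurable]: "F \<in> borel_measurable borel" "G \<in> borel_measurable borel"
    by (intro borel_measurable_mono distribution_fun_mono[OF assms(1) F X0]
      distribution_fun_mono[OF assms(2) G Y0])+
  note PX = prob_integral_transform[OF assms(1) F X0] and PY = prob_integral_transform[OF assms(2) G Y0]
  have le1: "F t \<le> 1" "G t \<le> 1" for t by (simp_all add: F G)
  consider "u = 0" | "v = 0" | "u = 1" | "v = 1" | "0 < u" "u < 1" "0 < v" "v < 1"
    using u v by fastforce
  then show ?thesis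
  proof cases
    case 1
    have "prob {\<omega>\<in>space M. F (X \<omega>) \<le> u \<and> G (Y \<omega>) \<le> v} \<le> prob {\<omega>\<in>space M. F (X \<omega>) \<le> u}"
      by (intro finite_measure_mono) auto
    then show ?thesis using 1 PX[OF u] copula_of_nonpos[OF \<mu>, of u v] by (simp add: measure_le_0_iff)
  next
    case 2
    have "prob {\<omega>\<in>space M. F (X \<omega>) \<le> u \<and> G (Y \<omega>) \<le> v} \<le> prob {\<omega>\<in>space M. G (Y \<omega>) \<le> v}"
      by (intro finite_measure_mono) auto
    then show ?thesis using 2 PY[OF v] copula_of_nonpos[OF \<mu>, of u v] by (simp add: measure_le_0_iff)
  next
    case 3
    then show ?thesis using PY[OF v] v by (simp add: le1 \<mu>.copula_of_1)
  next
    case 4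
    then show ?thesis using PX[OF u] u by (simp add: le1 \<mu>.copula_of_1)
  next
    case 5
    obtain a where a: "F a = u" "\<forall>t. F t \<le> u \<longleftrightarrow> t \<le> a"
      by (rule distribution_fun_level[OF assms(1) F X0 5(1,2)])
    obtain b where b: "G b = v" "\<forall>t. G t \<le> v \<longleftrightarrow> t \<le> b"
      by (rule distribution_fun_level[OF assms(2) G Y0 5(3,4)])
    show ?thesis using H[of a b] a b by simp
  qed
qed

theorem theorem5p7:
  fixes M :: "'a measure" and X Y :: "nat \<Rightarrow> 'a \<Rightarrow> real"
    and \<mu>A :: "(real \<times> real) measure" and KA :: "real \<Rightarrow> real measure"
    and s \<alpha> x :: real
  assumes "prob_space M"
    and iid_indep: "prob_space.indep_vars M (\<lambda>_. borel) (\<lambda>i \<omega>. (X i \<omega>, Y i \<omega>)) UNIV"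
    and iid_ident: "\<And>i. distr M borel (\<lambda>\<omega>. (X i \<omega>, Y i \<omega>)) = distr M borel (\<lambda>\<omega>. (X 0 \<omega>, Y 0 \<omega>))"
    and H_cont: "continuous_on UNIV (\<lambda>(a, b). measure M {\<omega>\<in>space M. X 0 \<omega> \<le> a \<and> Y 0 \<omega> \<le> b})"
    and A_copula: "doubly_stochastic \<mu>A"
    and H_eq: "\<And>a b. measure M {\<omega>\<in>space M. X 0 \<omega> \<le> a \<and> Y 0 \<omega> \<le> b} =
                 copula_of \<mu>A (measure M {\<omega>\<in>space M. X 0 \<omega> \<le> a})
                             (measure M {\<omega>\<in>space M. Y 0 \<omega> \<le> b})"
    and KA_cont: "continuous_markov_kernel_of \<mu>A KA"
    and s: "0 < s" "s < 1 / 2"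
    and \<alpha>: "0 < \<alpha>" "\<alpha> < 1"
    and regular: "AE \<omega> in M. unif_integrable_dfs (\<lambda>n y.
        cb_kernel (nat \<lfloor>real n powr s\<rfloor>) (emp_copula X Y n \<omega>) (emp_F X n \<omega> x) (emp_F Y n \<omega> y))"
  shows "AE \<omega> in M.
     (\<lambda>n. THE t. expectile_eq \<alpha> (\<lambda>y. cb_kernel (nat \<lfloor>real n powr s\<rfloor>) (emp_copula X Y n \<omega>)
                                        (emp_F X n \<omega> x) (emp_F Y n \<omega> y)) t)
     \<longlonglongrightarrow> (THE e. expectile_eq \<alpha> (\<lambda>y. measure (KA (measure M {\<omega>\<in>space M. X 0 \<omega> \<le> x}))
                                        {0..measure M {\<omega>\<in>space M. Y 0 \<omega> \<le> y}}) e)"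
proof -
  interpret prob_space M by fact
  let ?Z = "\<lambda>i \<omega>. (X i \<omega>, Y i \<omega>)"
  define F where "F a = prob {\<omega>\<in>space M. X 0 \<omega> \<le> a}" for a
  define G where "G a = prob {\<omega>\<in>space M. Y 0 \<omega> \<le> a}" for a
  have Z [measurable]: "random_variable borel (?Z i)" for i
    using iid_indep by (simp add: indep_vars_def)
  have XY [measurable]: "random_variable borel (X i)" "random_variable borel (Y i)" for i
    using measurable_compose[OF Z borel_measurable_continuous_onI[OF continuous_on_fst[OF continuous_on_id]], of i]
      measurable_compose[OF Z borel_measurable_continuous_onI[OF continuous_on_snd[OF continuous_on_id]], of i]
    by simp_all
  have prob_Z: "prob {\<omega>\<in>space M. ?Z i \<omega> \<in> S} = prob {\<omega>\<in>space M. ?Z 0 \<omega> \<in> S}" if "S \<in> sets borel" for i S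
  proof -
    have "prob {\<omega>\<in>space M. ?Z j \<omega> \<in> S} = measure (distr M borel (?Z j)) S" for j
      using that by (subst measure_distr) (auto intro!: arg_cong[where f=prob])
    then show ?thesis using iid_ident[of i] by simp
  qed
  have X0: "prob {\<omega>\<in>space M. X 0 \<omega> = a} = 0" for a
    by (rule prob_eq_0_of_joint_cdf_continuous[OF XY H_cont])
  \<comment> \<open>Exchanging the coordinates lets the argument for X serve for Y.\<close>
  have "continuous_on UNIV (\<lambda>p. (\<lambda>(a, b). prob {\<omega>\<in>space M. X 0 \<omega> \<le> a \<and> Y 0 \<omega> \<le> b}) (snd p, fst p))"
    by (rule continuous_on_compose2[OF H_cont]) (auto intro!: continuous_intros)
  then have H_cont': "continuous_on UNIV (\<lambda>(b, a). prob {\<omega>\<in>space M. Y 0 \<omega> \<le> b \<and> X 0 \<omega> \<le> a})"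
    by (simp add: case_prod_unfold conj_commute)
  have Y0: "prob {\<omega>\<in>space M. Y 0 \<omega> = a} = 0" for a
    by (rule prob_eq_0_of_joint_cdf_continuous[OF XY(2) XY(1) H_cont'])
  have mono: "mono F" "mono G"
    by (rule distribution_fun_mono[OF XY(1) F_def X0] distribution_fun_mono[OF XY(2) G_def Y0])+
  have [measurable]: "F \<in> borel_measurable borel" "G \<in> borel_measurable borel"
    by (intro borel_measurable_mono mono)+
  have range: "F t \<in> {0..1}" "G t \<in> {0..1}" for t by (simp_all add: F_def G_def)
  define UV where "UV i \<omega> = (F (X i \<omega>), G (Y i \<omega>))" for i \<omega>
  have [measurable]: "(\<lambda>p. (F (fst p), G (snd p))) \<in> borel_measurable (borel :: (real \<times> real) measure)"
    unfolding borel_prod[symmetric] by measurable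
  have indep_UV: "indep_vars (\<lambda>_. borel) UV UNIV"
    using indep_vars_compose2[OF iid_indep, of "\<lambda>_ p. (F (fst p), G (snd p))" "\<lambda>_. borel"]
    by (simp add: UV_def[abs_def])
  have prob_UV: "prob {\<omega>\<in>space M. UV i \<omega> \<in> S} = prob {\<omega>\<in>space M. UV 0 \<omega> \<in> S}" if S: "S \<in> sets borel" for i S
    using prob_Z[of "(\<lambda>p. (F (fst p), G (snd p))) -` S" i] measurable_sets[OF _ S, of "\<lambda>p. (F (fst p), G (snd p))" borel]
    by (simp add: UV_def)
  \<comment> \<open>The grid bound with c = 1/2 - s, which is positive by the choice of s.\<close>
  have err: "AE \<omega> in M. eventually (\<lambda>n. \<forall>p\<le>n. \<forall>q\<le>n.
      \<bar>real (card {k\<in>{..<n}. UV k \<omega> \<in> {..real p / real n} \<times> {..real q / real n}}) / real n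
        - copula_of \<mu>A (real p / real n) (real q / real n)\<bar> \<le> real n powr ((1 / 2 - s - 1) / 2)) sequentially"
  proof (rule AE_empirical_grid[OF indep_UV])
    fix i n p q :: nat assume pq: "p \<le> n" "q \<le> n"
    have *: "real p / real n \<in> {0..1}" "real q / real n \<in> {0..1}"
      using pq by (auto simp: divide_le_eq_1)
    have "prob {\<omega>\<in>space M. UV i \<omega> \<in> {..real p / real n} \<times> {..real q / real n}} =
        prob {\<omega>\<in>space M. UV 0 \<omega> \<in> {..real p / real n} \<times> {..real q / real n}}"
      by (rule prob_UV) (simp add: borel_prod[symmetric])
    also have "\<dots> = copula_of \<mu>A (real p / real n) (real q / real n)"
      using prob_integral_transform_joint[OF XY(1) XY(2) F_def G_def X0 Y0 A_copula _ *] H_eq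
      by (simp add: UV_def F_def[symmetric] G_def[symmetric])
    finally show "prob {\<omega>\<in>space M. UV i \<omega> \<in> {..real p / real n} \<times> {..real q / real n}} =
      copula_of \<mu>A (real p / real n) (real q / real n)" .
  qed (use s in \<open>auto simp: borel_prod[symmetric]\<close>)
  \<comment> \<open>Stated for a general \<open>f\<close>, later the two projections. There are
    countably many pairs of indices, and each pair is an instance of
    \<open>AE_indep_neq\<close>.\<close>
  have distinct: "AE \<omega> in M. inj (\<lambda>k. f (UV k \<omega>))"
    if f [measurable]: "f \<in> borel_measurable borel" and f0: "\<And>a. prob {\<omega>\<in>space M. f (UV 0 \<omega>) = a} = 0"
    for f :: "real \<times> real \<Rightarrow> real"
  proof -
    have "AE \<omega> in M. \<forall>i j. i \<noteq> j \<longrightarrow> f (UV i \<omega>) \<noteq> f (UV j \<omega>)"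
      unfolding AE_all_countable
    proof (intro allI)
      fix i j :: nat
      show "AE \<omega> in M. i \<noteq> j \<longrightarrow> f (UV i \<omega>) \<noteq> f (UV j \<omega>)"
      proof (cases "i = j")
        case False
        have "indep_vars (\<lambda>_. borel) (\<lambda>k \<omega>. f (UV k \<omega>)) (insert i {j})"
          by (rule indep_vars_subset[OF indep_vars_compose2[OF indep_UV f]]) simp
        \<comment> \<open>The sum is taken over the one-element set {j}, which turns independence of
          the family into independence of the pair.\<close>
        from indep_vars_sum[OF _ _ this] False
        have "indep_var borel (\<lambda>\<omega>. f (UV i \<omega>)) borel (\<lambda>\<omega>. f (UV j \<omega>))" by simp
        moreover have "prob {\<omega>\<in>space M. f (UV j \<omega>) = a} = 0" for a
        proof -
          have "f -` {a} \<in> sets borel" using measurable_sets[OF f, of "{a}"] by simp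
          from prob_UV[OF this, of j] show ?thesis using f0[of a] by simp
        qed
        ultimately have "AE \<omega> in M. f (UV i \<omega>) \<noteq> f (UV j \<omega>)" by (rule AE_indep_neq)
        then show ?thesis by simp
      qed simp
    qed
    then show ?thesis by eventually_elim (auto simp: inj_def)
  qed
  have inj: "AE \<omega> in M. inj (\<lambda>k. F (X k \<omega>))" "AE \<omega> in M. inj (\<lambda>k. G (Y k \<omega>))"
  proof -
    have "fst \<in> borel_measurable (borel :: (real \<times> real) measure)" "snd \<in> borel_measurable (borel :: (real \<times> real) measure)"
      by (auto intro!: borel_measurable_continuous_onI continuous_intros)
    from distinct[OF this(1)] distinct[OF this(2)]
    show "AE \<omega> in M. inj (\<lambda>k. F (X k \<omega>))" "AE \<omega> in M. inj (\<lambda>k. G (Y k \<omega>))"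
      using prob_integral_transform_no_atoms[OF XY(1) F_def X0] prob_integral_transform_no_atoms[OF XY(2) G_def Y0]
      by (simp_all add: UV_def)
  qed
  \<comment> \<open>None of these almost sure conditions mentions y, so one null set serves all
    y.\<close>
  show ?thesis
    unfolding F_def[symmetric] G_def[symmetric]
    using regular err inj
  proof eventually_elim
    case (elim \<omega>)
    define D where "D n y = cb_kernel (nat \<lfloor>real n powr s\<rfloor>) (emp_copula X Y n \<omega>) (emp_F X n \<omega> x) (emp_F Y n \<omega> y)" for n y
    have injX: "inj_on (\<lambda>k. X k \<omega>) {..<n}" "inj_on (\<lambda>k. Y k \<omega>) {..<n}" for n
      using elim(3,4) by (auto simp: inj_def inj_on_def)
    have df: "mono (D n)" "continuous (at_right a) (D n)" "(D n \<longlongrightarrow> 0) at_bot" "(D n \<longlongrightarrow> 1) at_top"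
      if n: "n \<ge> 1" for n a
    proof -
      note mu = emp_copula_mu_of[where X=X and Y=Y and \<omega>=\<omega>, OF n injX]
      have ds: "doubly_stochastic (mu_of (emp_copula X Y n \<omega>))" unfolding mu(2) by (rule mu(1))
      have Dn: "D n = (\<lambda>y. cb_kernel (nat \<lfloor>real n powr s\<rfloor>) (emp_copula X Y n \<omega>) (emp_F X n \<omega> x) (emp_F Y n \<omega> y))"
        by (simp add: D_def fun_eq_iff)
      note df = cb_kernel_emp_df[OF ds nat_floor_powr_ge_1[OF n less_imp_le[OF s(1)]] n emp_F_range[OF n]]
      show "mono (D n)" unfolding Dn by (rule df(1))
      show "continuous (at_right a) (D n)" unfolding Dn by (rule df(2))
      show "(D n \<longlongrightarrow> 0) at_bot" unfolding Dn by (rule df(3))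
      show "(D n \<longlongrightarrow> 1) at_top" unfolding Dn by (rule df(4))
    qed
    have bounds: "0 \<le> D n y" "D n y \<le> 1" if "n \<ge> 1" for n y
      using df_bounds[OF df[OF that]] by auto
    \<comment> \<open>The index is shifted because distribution functions and tail bounds are
      available for n \<ge> 1 only.\<close>
    have "(\<lambda>n. THE t. expectile_eq \<alpha> (D (Suc n)) t) \<longlonglongrightarrow> (THE t. expectile_eq \<alpha> (\<lambda>y. measure (KA (F x)) {0..G y}) t)"
    proof (rule expectile_tendsto[OF \<alpha>])
      show "mono (D (Suc n))" "0 \<le> D (Suc n) y" "D (Suc n) y \<le> 1" for n y
        using df(1)[of "Suc n"] bounds[of "Suc n"] by auto
      show "(\<lambda>n. D (Suc n) y) \<longlonglongrightarrow> measure (KA (F x)) {0..G y}" for y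
        unfolding D_def using elim(2)
        by (intro emp_cb_kernel_tendsto[where X=X and Y=Y and \<omega>=\<omega>, OF A_copula KA_cont s mono(1) range(1) mono(2) range(2) elim(3,4)])
          (simp add: UV_def)
      fix \<epsilon> :: real assume "\<epsilon> > 0"
      have "unif_integrable_dfs D" using elim(1) by (simp add: D_def[abs_def])
      from unif_integrable_dfs_tails[OF df this \<open>\<epsilon> > 0\<close>]
      obtain c where "\<forall>n\<ge>1. (\<integral>\<^sup>+y. ennreal ((1 - D n y) * indicator {c<..} y) \<partial>lborel) \<le> ennreal \<epsilon> \<and>
         (\<integral>\<^sup>+y. ennreal (D n y * indicator {..<-c} y) \<partial>lborel) \<le> ennreal \<epsilon>" by auto
      then show "\<exists>c. \<forall>n. (\<integral>\<^sup>+y. ennreal ((1 - D (Suc n) y) * indicator {c<..} y) \<partial>lborel) \<le> ennreal \<epsilon> \<and>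
         (\<integral>\<^sup>+y. ennreal (D (Suc n) y * indicator {..<-c} y) \<partial>lborel) \<le> ennreal \<epsilon>"
        by (intro exI[of _ c] allI) simp
    qed
    then show ?case
      unfolding D_def by (rule LIMSEQ_imp_Suc)
  qed
qed

end
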